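(* Let $P_0\subset\mathbb{R}^{d_0}$ and $P_1\subset\mathbb{R}^{d_1}$ be geometrically realised polytopes of dimensions $d_0,d_1\ge 1$ with $\dim(P_0\times P_1)=d_0+d_1\ge 3$. Consider the following two conditions. (A) There exist vertex-preserving realisations of $E(P_0)$ and $E(P_1)$. (B) For such realisations set $T_i:=V(E(P_i))\setminus V(P_i)$ for $i=0,1$. There are two maps $\beta_i:T_i\to\operatorname{int}(P_{1-i})$, $i=0,1$, such that for every $(v_0,v_1)\in T_0\times T_1$ the fraction (of the length) of the segment from $v_0$ to $\beta_1(v_1)$ lying outside $P_0$ equals the fraction of the segment from $v_1$ to $\beta_0(v_0)$ lying inside $P_1$. If $P_0,P_1$ satisfy (A) and (B), let $S\subset\mathbb{R}^{d_0}\times\mathbb{R}^{d_1}$ be the set consisting of (a) all pairs $(p_0,p_1)$ with $p_0\in V(P_0)$, $p_1\in V(P_1)$, (b) all pairs $(v_0,\beta_0(v_0))$ with $v_0\in T_0$, (c) all pairs $(\beta_1(v_1),v_1)$ with $v_1\in T_1$. Then $\operatorname{conv}(S)$ is a vertex-preserving polytopal realisation of $E(P_0\times P_1)$. Moreover, conditions (A) and (B) are both necessary and sufficient for the existence of a vertex-preserving realisation of $E(P_0\times P_1)$.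
   Context: $V(P)$ denotes the vertex set of a polytope $P$, and $\operatorname{int}(P)$ its interior. For a $d$-polytope, facets are faces of dimension $d-1$ and ridges are faces of dimension $d-2$; every ridge lies in exactly two facets. Product: $P_0\times P_1=\{(v,w)\in\mathbb{R}^{d_0+d_1}: v\in P_0,\ w\in P_1\}$ (the geometric orthogonal product). $E$-construction: for a $d$-polytope $P$, $d\ge 2$, $E(P)$ is the regular CW $(d-1)$-sphere obtained from the boundary of $P$ by (1) stellarly subdividing every facet $F$ (adding a new vertex $v_F$), and (2) merging the two facets of the subdivision that share a ridge of $P$. Thus combinatorially the facets of $E(P)$ correspond to the ridges $R=F\cap F'$ of $P$, the facet belonging to $R$ being the bipyramid over $R$ with apices $v_F,v_{F'}$. The proper faces of $E(P)$ are: the faces $G$ of $P$ with $\dim G\le d-3$ (including $\emptyset$); the pyramids $G*v_F$ for facets $F$ of $P$ and faces $G\subset F$ with $\dim G\le d-3$ (including $G=\emptyset$, which gives the vertex $v_F$); and the bipyramids over the ridges $R=F\cap F'$ of $P$ with apices $v_F,v_{F'}$; with the obvious inclusions. For $d\ge 3$ the vertices of $E(P)$ are the vertices of $P$ and the new vertices $v_F$; for $d=2$ the vertices of $E(P)$ are only the new vertices and each vertex of $P$ lies on a new edge (its facet is the edge from $v_F$ to $v_{F'}$). A polytopal realisation of $E(P)$ is a convex polytope whose face lattice is isomorphic to that of $E(P)$. It is called vertex-preserving, for a given geometrically realised polytope $P$, if it is obtained from this realisation of $P$ by placing one new vertex $v_F$ beyond each facet $F$ of $P$ and taking the convex hull (so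 that the facets are $\operatorname{conv}(R\cup\{v_F,v_{F'}\})$ for the ridges $R=F\cap F'$ of $P$; for $d=2$ the vertices of $P$ lie on the edges of $E(P)$). A point is beyond a facet $F$ if it lies strictly on the other side of the hyperplane of $F$ than $P$, and strictly on the same side as $P$ of every other facet hyperplane. For a segment $P$ ($d=1$), $E(P)$ is a segment containing $P$ in its interior. The set $T_i=V(E(P_i))\setminus V(P_i)$ is the set of new vertices, one beyond each facet of $P_i$. *)

theory Defs
  imports "HOL-Analysis.Analysis"
begin

text \<open>Polytopes are always full-dimensional here, i.e. \<open>aff_dim P = DIM('a)\<close>; hence
  \<open>interior P\<close> is the interior of \<open>P\<close>, and the affine hulls of facets are hyperplanes.\<close>

definition vertices :: "'a::euclidean_space set \<Rightarrow> 'a set" where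
  "vertices P = {x. x extreme_point_of P}"

definition facets :: "'a::euclidean_space set \<Rightarrow> 'a set set" where
  "facets P = {F. F facet_of P}"

definition ridge_of :: "'a::euclidean_space set \<Rightarrow> 'a set \<Rightarrow> bool" (infix "ridge'_of" 50) where
  "R ridge_of P \<longleftrightarrow> R face_of P \<and> aff_dim R = aff_dim P - 2"

definition outside_facet :: "'a::euclidean_space set \<Rightarrow> 'a set \<Rightarrow> 'a \<Rightarrow> bool" where
  "outside_facet P F x \<longleftrightarrow>
     (\<exists>a b. affine hull F = {y. a \<bullet> y = b} \<and> P \<subseteq> {y. a \<bullet> y \<le> b} \<and> a \<bullet> x > b)"

definition inside_facet :: "'a::euclidean_space set \<Rightarrow> 'a set \<Rightarrow> 'a \<Rightarrow> bool" where
  "inside_facet P F x \<longleftrightarrow>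
     (\<exists>a b. affine hull F = {y. a \<bullet> y = b} \<and> P \<subseteq> {y. a \<bullet> y \<le> b} \<and> a \<bullet> x < b)"

definition beyond :: "'a::euclidean_space set \<Rightarrow> 'a set \<Rightarrow> 'a \<Rightarrow> bool" where
  "beyond P F x \<longleftrightarrow>
     outside_facet P F x \<and> (\<forall>G \<in> facets P. G \<noteq> F \<longrightarrow> inside_facet P G x)"

text \<open>The face lattice of the sphere \<open>E(P)\<close> of a \<open>d\<close>-polytope, \<open>d \<ge> 2\<close>. The pair \<open>(G, A)\<close>
  of a face \<open>G\<close> of \<open>P\<close> and a set \<open>A\<close> of facets of \<open>P\<close> stands for the join of \<open>G\<close> with the new
  vertices \<open>v\<^sub>F\<close>, \<open>F \<in> A\<close>. The four parts are the old faces \<open>G\<close>, the pyramids \<open>G * v\<^sub>F\<close>, the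
  bipyramids over the ridges (a ridge lies in exactly two facets), and the improper top face.
  The empty face is \<open>({}, {})\<close>.\<close>

definition E_faces :: "'a::euclidean_space set \<Rightarrow> ('a set \<times> 'a set set) set" where
  "E_faces P =
     {(G, {}) | G. G face_of P \<and> aff_dim G \<le> aff_dim P - 3}
   \<union> {(G, {F}) | G F. F facet_of P \<and> G face_of P \<and> G \<subseteq> F \<and> aff_dim G \<le> aff_dim P - 3}
   \<union> {(R, {F \<in> facets P. R \<subseteq> F}) | R. R ridge_of P}
   \<union> {(P, facets P)}"

definition E_le :: "'a set \<times> 'a set set \<Rightarrow> 'a set \<times> 'a set set \<Rightarrow> bool" where
  "E_le X Y \<longleftrightarrow> fst X \<subseteq> fst Y \<and> snd X \<subseteq> snd Y"

definition polytopal_realisation_E ::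
    "'a::euclidean_space set \<Rightarrow> 'b::euclidean_space set \<Rightarrow> bool" where
  "polytopal_realisation_E P Q \<longleftrightarrow> polytope Q \<and>
     (\<exists>\<phi>. bij_betw \<phi> {K. K face_of Q} (E_faces P) \<and>
          (\<forall>K L. K face_of Q \<longrightarrow> L face_of Q \<longrightarrow> (K \<subseteq> L \<longleftrightarrow> E_le (\<phi> K) (\<phi> L))))"

text \<open>For a segment \<open>P\<close> (\<open>d = 1\<close>), \<open>E(P)\<close> is by convention a segment containing \<open>P\<close> in its
  interior; \<open>E_faces\<close> is not used then. For \<open>d = 2\<close> a ridge \<open>R\<close> is a vertex of \<open>P\<close>, and the last
  condition says that it lies on the edge from \<open>v F\<close> to \<open>v F'\<close>.\<close>

definition vertex_preserving_realisation_E ::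
    "'a::euclidean_space set \<Rightarrow> 'a set \<Rightarrow> bool" where
  "vertex_preserving_realisation_E P Q \<longleftrightarrow>
     (if aff_dim P = 1 then (\<exists>a b. Q = closed_segment a b) \<and> P \<subseteq> interior Q
      else polytopal_realisation_E P Q \<and>
        (\<exists>v. (\<forall>F \<in> facets P. beyond P F (v F) \<and> v F \<in> vertices Q) \<and>
             Q = convex hull (P \<union> v ` facets P) \<and>
             facets Q = {convex hull (R \<union> {v F, v F'}) | R F F'.
                R ridge_of P \<and> F \<in> facets P \<and> F' \<in> facets P \<and> F \<noteq> F' \<and> R = F \<inter> F'}))"

definition new_vertices :: "'a::euclidean_space set \<Rightarrow> 'a set \<Rightarrow> 'a set" where
  "new_vertices P Q = vertices Q - vertices P"

text \<open>The fraction of the length of the segment from \<open>x\<close> to \<open>y\<close> (\<open>x \<noteq> y\<close>) that lies in \<open>A\<close>,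
  measured in the constant-speed parametrisation over \<open>[0,1]\<close>.\<close>

definition segment_fraction :: "'a::euclidean_space \<Rightarrow> 'a \<Rightarrow> 'a set \<Rightarrow> real" where
  "segment_fraction x y A =
     measure lebesgue {t \<in> {0..1}. (1 - t) *\<^sub>R x + t *\<^sub>R y \<in> A}"

definition condition_B ::
    "'a::euclidean_space set \<Rightarrow> 'b::euclidean_space set \<Rightarrow> 'a set \<Rightarrow> 'b set \<Rightarrow>
     ('a \<Rightarrow> 'b) \<Rightarrow> ('b \<Rightarrow> 'a) \<Rightarrow> bool" where
  "condition_B P0 P1 T0 T1 \<beta>0 \<beta>1 \<longleftrightarrow>
     \<beta>0 \<in> T0 \<rightarrow> interior P1 \<and> \<beta>1 \<in> T1 \<rightarrow> interior P0 \<and>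
     (\<forall>v0 \<in> T0. \<forall>v1 \<in> T1.
        segment_fraction v0 (\<beta>1 v1) (- P0) = segment_fraction v1 (\<beta>0 v0) P1)"

definition product_points ::
    "'a::euclidean_space set \<Rightarrow> 'b::euclidean_space set \<Rightarrow> 'a set \<Rightarrow> 'b set \<Rightarrow>
     ('a \<Rightarrow> 'b) \<Rightarrow> ('b \<Rightarrow> 'a) \<Rightarrow> ('a \<times> 'b) set" where
  "product_points P0 P1 T0 T1 \<beta>0 \<beta>1 =
     {(p0, p1) | p0 p1. p0 \<in> vertices P0 \<and> p1 \<in> vertices P1}
   \<union> {(v0, \<beta>0 v0) | v0. v0 \<in> T0}
   \<union> {(\<beta>1 v1, v1) | v1. v1 \<in> T1}"

end

theory Submission
  imports Defs
begin

text \<open>Fix a full-dimensional polytope \<open>P\<close> and points \<open>v F\<close> beyond its facets \<open>F\<close>. For a ridge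
  \<open>F \<inter> F'\<close>, the hyperplane through \<open>F \<inter> F'\<close> and \<open>v F\<close> has \<open>P\<close> and all the new points other
  than \<open>v F'\<close> on one side; it contains \<open>v F'\<close> if and only if the segment from \<open>v F\<close> to \<open>v F'\<close> meets the affine
  hull of the ridge. Hence the convex hull of \<open>P\<close> and the \<open>v F\<close> is a vertex-preserving realisation
  of \<open>E(P)\<close> if and only if this holds for every ridge. A ridge of \<open>P\<^sub>0 \<times> P\<^sub>1\<close> is \<open>R \<times> P\<^sub>1\<close> or
  \<open>P\<^sub>0 \<times> R\<close> for a ridge \<open>R\<close> of a factor, where the condition is that of the factor, or \<open>F \<times> G\<close>
  for facets \<open>F\<close> and \<open>G\<close>. There it says that the segment from \<open>v\<^sub>0\<close> to \<open>\<beta>\<^sub>1(v\<^sub>1)\<close> enters \<open>P\<^sub>0\<close> at the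
  same parameter at which the segment from \<open>\<beta>\<^sub>0(v\<^sub>0)\<close> to \<open>v\<^sub>1\<close> leaves \<open>P\<^sub>1\<close>, which is condition (B).\<close>

text \<open>A supporting hyperplane makes each bipyramid a facet; the obstacle is to exclude further
  facets. A point of the hull that is no apex and has nonnegative height over \<open>F\<close> is
  projected from \<open>v F\<close> to the hyperplane of \<open>F\<close>. At the image, the height
  of a neighbour \<open>F'\<close> is a positive multiple of the ridge functional of
  \<open>F \<inter> F'\<close> at the point. If all ridge functionals are negative, the image lies
  in the relative interior of \<open>F\<close>, hence in the interior of the hull, and so does the
  point. Proper nonempty faces are intersections of facets, which reduces the face lattice to
  dimensions of intersected ridges and to common apices. Conversely, the hyperplane of a facet
  through a ridge and its two apices cuts the hyperplane of \<open>F\<close> exactly in the affine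
  hull of the ridge, which forces the crossing point to lie there. The criterion speaks only of the
  points \<open>v F\<close>; for a segment only \<open>beyond\<close> remains of it, so factors of
  all dimensions are treated alike. In a product, being beyond \<open>F \<times> P1\<close> forces
  the second coordinate into the interior of \<open>P1\<close>; hence the codomains in (B).\<close>

section \<open>Facet functionals\<close>

text \<open>For a segment \<open>P\<close> the empty face satisfies \<open>{} ridge_of P\<close>; the last conjunct excludes it.\<close>

definition adjacent :: "'a::euclidean_space set \<Rightarrow> 'a set \<Rightarrow> 'a set \<Rightarrow> bool" where
  "adjacent P F F' \<longleftrightarrow> F \<in> facets P \<and> F' \<in> facets P \<and> F \<noteq> F' \<and> F \<inter> F' ridge_of P \<and> F \<inter> F' \<noteq> {}"

definition facet_functional :: "'a::euclidean_space set \<Rightarrow> 'a set \<Rightarrow> ('a \<Rightarrow> real) \<Rightarrow> bool" where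
  "facet_functional P F h \<longleftrightarrow>
     (\<exists>a b. h = (\<lambda>x. a \<bullet> x - b) \<and> affine hull F = {y. a \<bullet> y = b} \<and> P \<subseteq> {y. a \<bullet> y \<le> b})"

text \<open>A fixed representative: the functionals of one facet differ by a positive factor, so
  only signs and ratios of heights carry meaning.\<close>

definition height :: "'a::euclidean_space set \<Rightarrow> 'a set \<Rightarrow> 'a \<Rightarrow> real" where
  "height P F = (SOME h. facet_functional P F h)"

lemma facet_functional_segment:
  assumes "facet_functional P F h"
  shows "h ((1 - t) *\<^sub>R x + t *\<^sub>R y) = (1 - t) * h x + t * h y"
  using assms by (auto simp: facet_functional_def algebra_simps)

lemma facet_functional_zero_iff:
  "facet_functional P F h \<Longrightarrow> h x = 0 \<longleftrightarrow> x \<in> affine hull F"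
  by (auto simp: facet_functional_def)

lemma facet_functional_nonpos:
  "facet_functional P F h \<Longrightarrow> x \<in> P \<Longrightarrow> h x \<le> 0"
  by (auto simp: facet_functional_def)

lemma segment_zero:
  fixes u w :: real
  assumes "u < 0" "0 < w"
  obtains s where "0 < s" "s < 1" "(1 - s) * u + s * w = 0"
proof -
  have "0 < - u / (w - u)" "- u / (w - u) < 1" using assms by (simp_all add: divide_simps)
  moreover have "(1 - - u / (w - u)) * u + - u / (w - u) * w = 0"
    using assms by (simp add: divide_simps)
  ultimately show thesis using that by blast
qed

locale full_polytope =
  fixes P :: "'a::euclidean_space set"
  assumes polytope: "polytope P" and full: "aff_dim P = int DIM('a)"
begin

lemma polyhedron: "polyhedron P"
  and convex: "convex P"
  and compact: "compact P"
  and bounded: "bounded P"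
  and affine_hull_UNIV: "affine hull P = UNIV"
  and rel_interior_eq: "rel_interior P = interior P"
  and interior_nonempty: "interior P \<noteq> {}"
  and not_empty: "P \<noteq> {}"
proof -
  show "polyhedron P" "convex P" "compact P" "bounded P"
    using polytope polytope_imp_polyhedron polytope_imp_convex polytope_imp_compact
      polytope_imp_bounded by auto
  show *: "affine hull P = UNIV"
    using full aff_dim_eq_full by blast
  show "rel_interior P = interior P"
    using * rel_interior_interior by blast
  show "P \<noteq> {}" using full by auto
  then show "interior P \<noteq> {}"
    using \<open>rel_interior P = interior P\<close> \<open>convex P\<close> rel_interior_eq_empty by metis
qed

lemma facet_face: "F \<in> facets P \<Longrightarrow> F face_of P"
  and facet_subset: "F \<in> facets P \<Longrightarrow> F \<subseteq> P"
  and facet_nonempty: "F \<in> facets P \<Longrightarrow> F \<noteq> {}"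
  and facet_aff_dim: "F \<in> facets P \<Longrightarrow> aff_dim F = int DIM('a) - 1"
  and facet_convex: "F \<in> facets P \<Longrightarrow> convex F"
  using full face_of_imp_subset face_of_imp_convex
  by (auto simp: facets_def facet_of_def)

lemma finite_facets: "finite (facets P)"
  unfolding facets_def by (rule finite_polyhedron_facets[OF polyhedron])

lemma affine_facet_Int: "F \<in> facets P \<Longrightarrow> affine hull F \<inter> P = F"
  using face_of_imp_eq_affine_Int[OF convex facet_face] by blast

lemma facet_subset_eq:
  assumes "F \<in> facets P" "G \<in> facets P" "F \<subseteq> G"
  shows "F = G"
proof -
  have "affine hull F = affine hull G"
    using assms facet_aff_dim aff_dim_eq_full_gen by metis
  then show ?thesis using affine_facet_Int assms by blast
qed

text \<open>A hyperplane that cuts out \<open>F\<close> contains its affine hull; both have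
  dimension d - 1, so they agree.\<close>

lemma facet_functional_exists:
  assumes "F \<in> facets P"
  obtains a b where "a \<noteq> 0" "affine hull F = {y. a \<bullet> y = b}" "P \<subseteq> {y. a \<bullet> y \<le> b}"
proof -
  obtain a b where ab: "a \<noteq> 0" "P \<subseteq> {y. a \<bullet> y \<le> b}" "F = P \<inter> {x. a \<bullet> x = b}"
    using facet_of_polyhedron[OF polyhedron] assms by (auto simp: facets_def)
  have "affine hull F = {y. a \<bullet> y = b}"
  proof (rule affine_dim_equal)
    show "affine hull F \<subseteq> {y. a \<bullet> y = b}"
      using ab by (intro hull_minimal) (auto simp: affine_hyperplane)
    show "aff_dim (affine hull F) = aff_dim {y. a \<bullet> y = b}"
      using facet_aff_dim[OF assms] ab
      by (simp add: aff_dim_hyperplane of_nat_diff DIM_positive Suc_leI)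
  qed (use facet_nonempty[OF assms] in \<open>auto simp: affine_hyperplane\<close>)
  then show thesis using ab that by blast
qed

lemma height:
  assumes "F \<in> facets P"
  shows "facet_functional P F (height P F)"
proof -
  obtain a b where "a \<noteq> 0" "affine hull F = {y. a \<bullet> y = b}" "P \<subseteq> {y. a \<bullet> y \<le> b}"
    by (rule facet_functional_exists[OF assms])
  then have "facet_functional P F (\<lambda>x. a \<bullet> x - b)"
    unfolding facet_functional_def by (intro exI[of _ a] exI[of _ b]) simp
  then show ?thesis unfolding height_def by (rule someI[of "facet_functional P F"])
qed

lemmas height_segment = facet_functional_segment[OF height]
lemmas height_zero_iff = facet_functional_zero_iff[OF height]
lemmas height_nonpos = facet_functional_nonpos[OF height]

lemma height_facet: "F \<in> facets P \<Longrightarrow> x \<in> F \<Longrightarrow> height P F x = 0"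
  by (simp add: height_zero_iff hull_inc)

lemma height_zero_imp: "F \<in> facets P \<Longrightarrow> x \<in> P \<Longrightarrow> height P F x = 0 \<Longrightarrow> x \<in> F"
  using affine_facet_Int[of F] height_zero_iff[of F x] by auto

lemma functional_interior:
  assumes "F \<in> facets P" "facet_functional P F h" "p \<in> interior P"
  shows "h p < 0"
proof -
  have "h p \<noteq> 0"
  proof
    assume "h p = 0"
    then have "p \<in> F"
      using assms affine_facet_Int[of F] facet_functional_zero_iff[of P F h p]
        interior_subset[of P] by auto
    moreover have "F \<noteq> P" using facet_aff_dim[OF assms(1)] full by auto
    ultimately show False
      using face_of_disjoint_interior[OF facet_face] assms by blast
  qed
  then show ?thesis
    using facet_functional_nonpos assms interior_subset
    by (metis less_eq_real_def subsetD)
qed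

text \<open>Both functionals have the hull of \<open>F\<close> as zero set. The segment from an
  interior point to \<open>x\<close> crosses it, and an affine function that is negative at the
  start and zero at an inner point is positive at the end.\<close>

lemma functional_pos:
  assumes "F \<in> facets P" "facet_functional P F h" "facet_functional P F k" "h x > 0"
  shows "k x > 0"
proof -
  obtain p where p: "p \<in> interior P" using interior_nonempty by blast
  have hk: "h p < 0" "k p < 0" using functional_interior assms p by blast+
  obtain s where s: "0 < s" "s < 1" "(1 - s) * h p + s * h x = 0"
    using segment_zero hk assms by metis
  then have "k ((1 - s) *\<^sub>R p + s *\<^sub>R x) = 0"
    using assms by (metis facet_functional_segment facet_functional_zero_iff)
  then have "(1 - s) * k p + s * k x = 0"
    using facet_functional_segment assms by metis
  moreover have "(1 - s) * k p < 0" using s hk by (simp add: mult_pos_neg)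
  ultimately have "s * k x > 0" by linarith
  then show ?thesis using s zero_less_mult_pos by blast
qed

text \<open>The definition admits every equation of the hyperplane; since the sign does not depend
  on the choice, a single functional decides.\<close>

lemma outside_facet_functional:
  assumes "F \<in> facets P" "facet_functional P F h"
  shows "outside_facet P F x \<longleftrightarrow> h x > 0"
proof
  assume "outside_facet P F x"
  then obtain k where "facet_functional P F k" "k x > 0"
    unfolding outside_facet_def facet_functional_def by fastforce
  then show "h x > 0" using functional_pos assms by blast
next
  assume "h x > 0"
  then show "outside_facet P F x" using assms(2)
    unfolding outside_facet_def facet_functional_def by fastforce
qed

lemma inside_facet_functional:
  assumes "F \<in> facets P" "facet_functional P F h"
  shows "inside_facet P F x \<longleftrightarrow> h x < 0"
proof
  assume "inside_facet P F x"
  then obtain k where k: "facet_functional P F k" "k x < 0"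
    unfolding inside_facet_def facet_functional_def by fastforce
  then have "\<not> h x > 0" using functional_pos[OF assms k(1), of x] by auto
  moreover have "h x \<noteq> 0"
    using k assms facet_functional_zero_iff by (metis less_irrefl)
  ultimately show "h x < 0" by auto
next
  assume "h x < 0"
  then show "inside_facet P F x" using assms(2)
    unfolding inside_facet_def facet_functional_def by fastforce
qed

lemmas outside_iff = outside_facet_functional[OF _ height]
lemmas inside_iff = inside_facet_functional[OF _ height]
lemmas height_interior = functional_interior[OF _ height]

lemma beyond_iff:
  assumes "F \<in> facets P"
  shows "beyond P F x \<longleftrightarrow> height P F x > 0 \<and> (\<forall>G \<in> facets P. G \<noteq> F \<longrightarrow> height P G x < 0)"
  using assms by (auto simp: beyond_def outside_iff inside_iff)

end

text \<open>The ray from \<open>p\<close> through \<open>x\<close> first leaves the relative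
  interior at a frontier point, hence on a facet, and no later than at \<open>x\<close>. The value
  \<open>t = 1\<close> is the case of \<open>x\<close> on the frontier.\<close>

lemma segment_exits_facet:
  fixes S :: "'a::euclidean_space set"
  assumes "polytope S" and p: "p \<in> rel_interior S" and x: "x \<in> affine hull S" "x \<notin> rel_interior S"
  obtains F t where "F facet_of S" "0 < t" "t \<le> 1" "(1 - t) *\<^sub>R p + t *\<^sub>R x \<in> F"
proof -
  have "x - p \<noteq> 0" using p x by auto
  moreover have "p + (x - p) \<in> affine hull S" using x by simp
  ultimately obtain d where d: "0 < d" "p + d *\<^sub>R (x - p) \<in> rel_frontier S"
      "\<And>e. \<lbrakk>0 \<le> e; e < d\<rbrakk> \<Longrightarrow> p + e *\<^sub>R (x - p) \<in> rel_interior S"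
    using ray_to_rel_frontier[OF _ p] polytope_imp_bounded[OF assms(1)] by metis
  have "d \<le> 1"
    using d(3)[of 1] x by force
  moreover have "rel_frontier S = \<Union> {F. F facet_of S}"
    using rel_frontier_of_polyhedron polytope_imp_polyhedron assms(1) by blast
  moreover have "p + d *\<^sub>R (x - p) = (1 - d) *\<^sub>R p + d *\<^sub>R x"
    by (simp add: algebra_simps)
  ultimately show thesis using that d by auto
qed

section \<open>Facet inequalities and ridges\<close>

context full_polytope
begin

text \<open>Along the segment from an interior point, the height of the exit facet is negative at
  the start and zero at the exit, hence nonnegative at \<open>x\<close>. A point outside
  \<open>P\<close> lies strictly past the exit, which makes the height positive.\<close>

lemma notin_interior_imp:
  assumes "x \<notin> interior P"
  obtains F where "F \<in> facets P" "height P F x \<ge> 0" "x \<notin> P \<Longrightarrow> height P F x > 0"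
proof -
  obtain p where p: "p \<in> interior P" using interior_nonempty by blast
  obtain F t where F: "F \<in> facets P" and t: "0 < t" "t \<le> 1" and q: "(1 - t) *\<^sub>R p + t *\<^sub>R x \<in> F"
    using segment_exits_facet[OF polytope, of p x] p assms
    by (auto simp: rel_interior_eq affine_hull_UNIV facets_def)
  have 0: "(1 - t) * height P F p + t * height P F x = 0"
    using height_facet[OF F q] height_segment[OF F] by metis
  have neg: "height P F p < 0" using height_interior F p by blast
  then have "(1 - t) * height P F p \<le> 0" using t by (simp add: mult_nonneg_nonpos)
  then have "height P F x \<ge> 0" using 0 t by (smt (verit) mult_pos_neg)
  moreover have "height P F x > 0" if "x \<notin> P"
  proof -
    have "t \<noteq> 1" using q that facet_subset[OF F] by auto
    then have "(1 - t) * height P F p < 0" using t neg by (simp add: mult_pos_neg)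
    then show ?thesis using 0 t by (smt (verit) zero_less_mult_pos)
  qed
  ultimately show thesis using F that by blast
qed

lemma interior_iff: "x \<in> interior P \<longleftrightarrow> (\<forall>F \<in> facets P. height P F x < 0)"
proof
  assume *: "\<forall>F \<in> facets P. height P F x < 0"
  show "x \<in> interior P"
  proof (rule ccontr)
    assume "x \<notin> interior P"
    then obtain F where "F \<in> facets P" "height P F x \<ge> 0" by (rule notin_interior_imp)
    then show False using * by fastforce
  qed
qed (use height_interior in blast)

lemma mem_iff: "x \<in> P \<longleftrightarrow> (\<forall>F \<in> facets P. height P F x \<le> 0)"
proof
  assume *: "\<forall>F \<in> facets P. height P F x \<le> 0"
  show "x \<in> P"
  proof (rule ccontr)
    assume x: "x \<notin> P"
    then have "x \<notin> interior P" using interior_subset by blast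
    then obtain F where "F \<in> facets P" "height P F x > 0"
      using notin_interior_imp[of x] x by metis
    then show False using * x by fastforce
  qed
qed (use height_nonpos in blast)

text \<open>A face is the intersection of the facets through it, so a second facet \<open>F'\<close>
  contains \<open>R\<close>. As a proper face of \<open>F\<close>, \<open>F \<inter> F'\<close> has
  dimension at most d - 2 and cannot exceed its face \<open>R\<close>.\<close>

lemma ridge_two_facets:
  assumes R: "R ridge_of P" "R \<noteq> {}" and F: "F \<in> facets P" "R \<subseteq> F"
  obtains F' where "F' \<in> facets P" "F' \<noteq> F" "R = F \<inter> F'"
proof -
  have Rf: "R face_of P" "aff_dim R = int DIM('a) - 2"
    using R full by (auto simp: ridge_of_def)
  have "R \<noteq> P" "R \<noteq> F" using Rf full facet_aff_dim[OF F(1)] by auto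
  then have "R = \<Inter>{F. F facet_of P \<and> R \<subseteq> F}"
    using face_of_polyhedron[OF polyhedron Rf(1)] R by blast
  then obtain F' where F': "F' \<in> facets P" "R \<subseteq> F'" "F' \<noteq> F"
    using \<open>R \<noteq> F\<close> F unfolding facets_def by blast
  have face: "F \<inter> F' face_of P" using face_of_Int facet_face F F' by blast
  have ne: "F \<inter> F' \<noteq> F" using facet_subset_eq[OF F(1) F'(1)] F'(3) by blast
  have "F \<inter> F' face_of F"
    using face face_of_subset facet_subset[OF F(1)] by (metis inf_le1)
  then have "aff_dim (F \<inter> F') < int DIM('a) - 1"
    using face_of_aff_dim_lt[OF facet_convex[OF F(1)]] ne facet_aff_dim[OF F(1)] by auto
  moreover have sub: "R \<subseteq> F \<inter> F'" using F F' by blast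
  moreover have "R face_of (F \<inter> F')"
    using sub Rf face_of_subset face by (meson face_of_imp_subset)
  ultimately have "R = F \<inter> F'"
    using face_of_aff_dim_lt[of "F \<inter> F'" R] Rf face_of_imp_convex[OF face] by force
  then show thesis using F' that by blast
qed

lemma rel_interior_facet_notin:
  assumes F: "F \<in> facets P" and x: "x \<in> rel_interior F" and G: "G \<in> facets P" "G \<noteq> F"
  shows "x \<notin> G"
  using subset_of_face_of[OF facet_face[OF G(1)] facet_subset[OF F]] x facet_subset_eq[OF F G(1)] G(2)
  by blast

text \<open>The height of a third facet \<open>G\<close> through the ridge would be a positive
  combination of the heights of \<open>F\<close> and \<open>F'\<close>. Being nonpositive, these
  would vanish on \<open>G\<close>, which puts \<open>G\<close> inside \<open>F\<close>.\<close>

lemma facets_of_ridge: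
  assumes R: "F \<inter> F' ridge_of P" "F \<inter> F' \<noteq> {}" and F: "F \<in> facets P" "F' \<in> facets P" "F \<noteq> F'"
  shows "{G \<in> facets P. F \<inter> F' \<subseteq> G} = {F, F'}"
proof -
  have "G \<in> {F, F'}" if G: "G \<in> facets P" "F \<inter> F' \<subseteq> G" for G
  proof (rule ccontr)
    assume neq: "G \<notin> {F, F'}"
    obtain p where p: "p \<in> F" "p \<notin> F'" "p \<notin> G"
    proof -
      obtain p where p: "p \<in> rel_interior F"
        using facet_nonempty facet_convex rel_interior_eq_empty F by blast
      then have "p \<notin> F'" "p \<notin> G"
        using rel_interior_facet_notin[OF F(1) p] F G(1) neq by blast+
      then show thesis using that p rel_interior_subset by blast
    qed
    obtain q where q: "q \<in> F'" "q \<notin> F" "q \<notin> G"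
    proof -
      obtain p where p: "p \<in> rel_interior F'"
        using facet_nonempty facet_convex rel_interior_eq_empty F by blast
      then have "p \<notin> F" "p \<notin> G"
        using rel_interior_facet_notin[OF F(2) p] F G(1) neq by blast+
      then show thesis using that p rel_interior_subset by blast
    qed
    have neg: "height P F' p < 0" "height P G p < 0" "height P F q < 0" "height P G q < 0"
      using p q F G height_nonpos height_zero_imp facet_subset by (metis less_eq_real_def subsetD)+
    \<comment> \<open>The constants make \<open>k\<close> vanish at \<open>q\<close> and
      \<open>p\<close>: \<open>height P F' q = 0\<close> leaves only the \<alpha> term there, and
      \<open>height P F p = 0\<close> only the \<beta> term. Both are quotients of negative
      numbers.\<close>
    define \<alpha> where "\<alpha> = height P G q / height P F q"
    define \<beta> where "\<beta> = height P G p / height P F' p"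
    have pos: "\<alpha> > 0" "\<beta> > 0" using neg by (auto simp: \<alpha>_def \<beta>_def divide_neg_neg)
    define k where "k x = \<alpha> * height P F x + \<beta> * height P F' x - height P G x" for x
    obtain a1 b1 a2 b2 a3 b3 where ab: "height P F = (\<lambda>x. a1 \<bullet> x - b1)"
      "height P F' = (\<lambda>x. a2 \<bullet> x - b2)" "height P G = (\<lambda>x. a3 \<bullet> x - b3)"
      using height F G unfolding facet_functional_def by metis
    have "{x. k x = 0} = {x. (\<alpha> *\<^sub>R a1 + \<beta> *\<^sub>R a2 - a3) \<bullet> x = \<alpha> * b1 + \<beta> * b2 - b3}"
      by (auto simp: k_def ab inner_diff_left inner_add_left algebra_simps)
    then have aff: "affine {x. k x = 0}" by (metis affine_hyperplane)
    have kR: "k x = 0" if "x \<in> F \<inter> F'" for x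
      using that F G height_facet by (auto simp: k_def)
    have kp: "k p = 0" "k q = 0"
      using p q F neg height_facet by (auto simp: k_def \<alpha>_def \<beta>_def)
    have 1: "p \<notin> affine hull (F \<inter> F')" "q \<notin> affine hull (insert p (F \<inter> F'))"
    proof -
      have "affine hull (F \<inter> F') \<subseteq> affine hull F'" by (simp add: hull_mono)
      then show "p \<notin> affine hull (F \<inter> F')"
        using height_zero_iff[OF F(2)] neg by force
      have "affine hull (insert p (F \<inter> F')) \<subseteq> affine hull F" using p by (simp add: hull_mono)
      then show "q \<notin> affine hull (insert p (F \<inter> F'))"
        using height_zero_iff[OF F(1)] neg by force
    qed
    \<comment> \<open>The ridge has dimension d - 2, so two affinely independent additions span the
      whole space and \<open>k\<close> vanishes identically.\<close>
    then have "aff_dim (insert q (insert p (F \<inter> F'))) = aff_dim (F \<inter> F') + 2"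
      by (subst aff_dim_insert, simp, subst aff_dim_insert, simp)
    then have "aff_dim (insert q (insert p (F \<inter> F'))) = int DIM('a)"
      using R full by (simp add: ridge_of_def)
    then have "affine hull (insert q (insert p (F \<inter> F'))) = UNIV"
      using aff_dim_eq_full by blast
    moreover have "affine hull (insert q (insert p (F \<inter> F'))) \<subseteq> {x. k x = 0}"
      using kR kp aff by (intro hull_minimal) auto
    ultimately have k0: "k x = 0" for x by auto
    have "G \<subseteq> F"
    proof
      fix x assume x: "x \<in> G"
      then have "\<alpha> * height P F x + \<beta> * height P F' x = 0"
        using k0[of x] height_facet[OF G(1)] by (simp add: k_def)
      moreover have "height P F x \<le> 0" "height P F' x \<le> 0"
        using height_nonpos F x facet_subset[OF G(1)] by blast+
      ultimately have "height P F x = 0"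
        using pos by (smt (verit) mult_pos_neg mult_nonneg_nonpos)
      then show "x \<in> F" using height_zero_imp F x facet_subset[OF G(1)] by blast
    qed
    then show False using facet_subset_eq G F neq by blast
  qed
  then show ?thesis using F by blast
qed

lemma facet_of_facet:
  assumes F: "F \<in> facets P" and R: "R facet_of F"
  obtains F' where "adjacent P F F'" "R = F \<inter> F'"
proof -
  have "R face_of P" using R facet_face[OF F] face_of_trans facet_of_imp_face_of by blast
  then have ridge: "R ridge_of P" "R \<noteq> {}" "R \<subseteq> F"
    using R facet_aff_dim[OF F] full by (auto simp: facet_of_def ridge_of_def face_of_imp_subset)
  then obtain F' where F': "F' \<in> facets P" "F' \<noteq> F" "R = F \<inter> F'"
    using ridge_two_facets F by metis
  then have "adjacent P F F'" using ridge F by (auto simp: adjacent_def)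
  then show thesis using that F' by blast
qed

text \<open>Neighbours of \<open>F\<close> control all facets: were \<open>x\<close> not in the
  relative interior of \<open>F\<close>, the segment from a relative interior point would leave
  \<open>F\<close> through a ridge \<open>F \<inter> F'\<close>. There \<open>height P F'\<close>
  would be zero, although it is nonpositive at one end and negative at the other.\<close>

lemma rel_interior_facet:
  assumes F: "F \<in> facets P" and x: "x \<in> affine hull F"
    and neg: "\<And>F'. adjacent P F F' \<Longrightarrow> height P F' x < 0"
    and G: "G \<in> facets P" "G \<noteq> F"
  shows "height P G x < 0"
proof -
  have polyF: "polytope F"
    using face_of_polytope_polytope[OF polytope facet_face[OF F]] .
  have "x \<in> rel_interior F"
  proof (rule ccontr)
    assume nx: "x \<notin> rel_interior F"
    obtain p where p: "p \<in> rel_interior F"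
      using facet_nonempty facet_convex rel_interior_eq_empty F by blast
    obtain R t where R: "R facet_of F" and t: "0 < t" "t \<le> 1" and q: "(1 - t) *\<^sub>R p + t *\<^sub>R x \<in> R"
      using segment_exits_facet[OF polyF p x nx] .
    obtain F' where adj: "adjacent P F F'" and RF: "R = F \<inter> F'" by (rule facet_of_facet[OF F R])
    then have F': "F' \<in> facets P" by (simp add: adjacent_def)
    have "height P F' x < 0" by (rule neg[OF adj])
    moreover have "height P F' p \<le> 0"
      using p F height_nonpos[OF F'] rel_interior_subset facet_subset by blast
    moreover have "(1 - t) * height P F' p + t * height P F' x = 0"
      using height_facet[OF F'] q RF unfolding height_segment[OF F', symmetric] by blast
    ultimately show False using t
      by (smt (verit) mult_nonneg_nonpos mult_pos_neg)
  qed
  then have xF: "x \<in> F" "x \<in> P" using rel_interior_subset facet_subset F by blast+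
  have "x \<notin> G" by (rule rel_interior_facet_notin[OF F \<open>x \<in> rel_interior F\<close> G])
  then show ?thesis
    using height_nonpos[OF G(1) xF(2)] height_zero_imp[OF G(1) xF(2)] by fastforce
qed

end

section \<open>New vertices beyond the facets\<close>

text \<open>The hulls of two adjacent facets meet exactly in the hull of their ridge. Asking for
  both hulls makes the condition a common zero of two heights, and one that can be checked by
  coordinates in a product.\<close>

definition apices :: "'a::euclidean_space set \<Rightarrow> ('a set \<Rightarrow> 'a) \<Rightarrow> bool" where
  "apices P v \<longleftrightarrow> (\<forall>F \<in> facets P. beyond P F (v F)) \<and>
     (\<forall>F F'. adjacent P F F' \<longrightarrow>
        (\<exists>x \<in> closed_segment (v F) (v F'). x \<in> affine hull F \<and> x \<in> affine hull F'))"

text \<open>A face of the hull of a compact set is the hull of a subset of that set; here the subset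
  must lie in the hyperplane.\<close>

lemma convex_hull_Int_hyperplane:
  fixes S :: "'a::euclidean_space set"
  assumes "compact S" and le: "\<And>x. x \<in> S \<Longrightarrow> a \<bullet> x \<le> b"
  shows "(convex hull S \<inter> {x. a \<bullet> x = b}) face_of convex hull S"
    and "convex hull S \<inter> {x. a \<bullet> x = b} = convex hull (S \<inter> {x. a \<bullet> x = b})"
proof -
  have "convex hull S \<subseteq> {x. a \<bullet> x \<le> b}"
    using le by (intro hull_minimal) (auto simp: convex_halfspace_le)
  then show *: "(convex hull S \<inter> {x. a \<bullet> x = b}) face_of convex hull S"
    by (intro face_of_Int_supporting_hyperplane_le) auto
  obtain T where T: "T \<subseteq> S" "convex hull S \<inter> {x. a \<bullet> x = b} = convex hull T"
    using face_of_convex_hull_subset[OF assms(1) *] by blast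
  then have "T \<subseteq> S \<inter> {x. a \<bullet> x = b}" using hull_subset[of T convex] by blast
  then have "convex hull T \<subseteq> convex hull (S \<inter> {x. a \<bullet> x = b})" by (rule hull_mono)
  moreover have "convex hull (S \<inter> {x. a \<bullet> x = b}) \<subseteq> convex hull S \<inter> {x. a \<bullet> x = b}"
  proof (rule Int_greatest)
    show "convex hull (S \<inter> {x. a \<bullet> x = b}) \<subseteq> convex hull S" by (rule hull_mono) blast
    show "convex hull (S \<inter> {x. a \<bullet> x = b}) \<subseteq> {x. a \<bullet> x = b}"
      by (rule hull_minimal) (auto simp: convex_hyperplane)
  qed
  ultimately show "convex hull S \<inter> {x. a \<bullet> x = b} = convex hull (S \<inter> {x. a \<bullet> x = b})"
    using T by blast
qed

lemma polytope_convex_hull_Un_finite: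
  assumes "polytope S" "finite T"
  shows "polytope (convex hull (S \<union> T))"
proof -
  obtain V where V: "finite V" "S = convex hull V" using assms(1) by (auto simp: polytope_def)
  then have "convex hull (S \<union> T) = convex hull (V \<union> T)" by (metis hull_Un_left)
  then show ?thesis using V assms by (auto simp: polytope_def)
qed

locale stellar = full_polytope P for P :: "'a::euclidean_space set" +
  fixes v :: "'a set \<Rightarrow> 'a"
  assumes beyond: "F \<in> facets P \<Longrightarrow> beyond P F (v F)"
begin

definition Q where "Q = convex hull (P \<union> v ` facets P)"

lemma height_apex: "F \<in> facets P \<Longrightarrow> height P F (v F) > 0"
  and height_other: "F \<in> facets P \<Longrightarrow> G \<in> facets P \<Longrightarrow> G \<noteq> F \<Longrightarrow> height P G (v F) < 0"
  using beyond beyond_iff by blast+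

lemma apex_notin: "F \<in> facets P \<Longrightarrow> v F \<notin> P"
  using height_apex[of F] height_nonpos[of F "v F"] by fastforce

lemma apex_inj: "inj_on v (facets P)"
  by (rule inj_onI) (metis height_apex height_other less_asym)

lemma polytope_Q: "polytope Q"
  unfolding Q_def using polytope finite_facets by (intro polytope_convex_hull_Un_finite) auto

lemma convex_Q: "convex Q"
  by (simp add: Q_def)

lemma P_subset_Q: "P \<subseteq> Q"
  and apex_in_Q: "F \<in> facets P \<Longrightarrow> v F \<in> Q"
  unfolding Q_def using hull_subset[of "P \<union> v ` facets P" convex] by auto

lemma interior_P_subset: "interior P \<subseteq> interior Q"
  by (rule interior_mono[OF P_subset_Q])

lemma aff_dim_Q: "aff_dim Q = int DIM('a)"
  using interior_P_subset interior_nonempty aff_dim_nonempty_interior by blast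

lemma full_polytope_Q: "full_polytope Q"
  using polytope_Q aff_dim_Q by unfold_locales

lemma compact_generators: "compact (P \<union> v ` facets P)"
  using compact finite_facets by (simp add: compact_Un finite_imp_compact)

text \<open>The height of \<open>F\<close> itself supports this face: it is positive at
  \<open>v F\<close> and nonpositive at all other generators.\<close>

lemma apex_face:
  assumes F: "F \<in> facets P"
  shows "{v F} face_of Q"
proof -
  obtain a b where ab: "height P F = (\<lambda>x. a \<bullet> x - b)"
    using height[OF F] by (auto simp: facet_functional_def)
  have lt: "a \<bullet> x < a \<bullet> v F" if x: "x \<in> P \<union> v ` facets P" "x \<noteq> v F" for x
  proof -
    have "height P F x \<le> 0"
      using x height_nonpos[OF F] height_other F by (auto intro: less_imp_le)
    then show ?thesis using height_apex[OF F] ab by simp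
  qed
  have "(P \<union> v ` facets P) \<inter> {x. a \<bullet> x = a \<bullet> v F} = {v F}"
    using lt F by force
  moreover have "\<And>x. x \<in> P \<union> v ` facets P \<Longrightarrow> a \<bullet> x \<le> a \<bullet> v F"
    using lt by (metis less_imp_le order_refl)
  ultimately show ?thesis
    using convex_hull_Int_hyperplane[OF compact_generators, of a "a \<bullet> v F"] by (simp add: Q_def)
qed

lemma apex_vertex: "F \<in> facets P \<Longrightarrow> v F \<in> vertices Q"
  using apex_face by (simp add: vertices_def face_of_singleton)

lemma vertices_Q_subset: "vertices Q \<subseteq> P \<union> v ` facets P"
  unfolding vertices_def Q_def using extreme_point_of_convex_hull by blast

lemma new_vertices_Q: "new_vertices P Q = v ` facets P"
proof
  show "new_vertices P Q \<subseteq> v ` facets P"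
  proof
    fix x assume "x \<in> new_vertices P Q"
    then have x: "x extreme_point_of Q" "\<not> x extreme_point_of P"
      by (auto simp: new_vertices_def vertices_def)
    have "x \<notin> P" using x P_subset_Q unfolding extreme_point_of_def by blast
    then show "x \<in> v ` facets P" using x vertices_Q_subset by (auto simp: vertices_def)
  qed
  show "v ` facets P \<subseteq> new_vertices P Q"
    using apex_vertex apex_notin by (auto simp: new_vertices_def vertices_def extreme_point_of_def)
qed

lemma open_segment_apex:
  assumes "F \<in> facets P" "y \<in> interior Q" "0 < s" "s < 1" "x = (1 - s) *\<^sub>R y + s *\<^sub>R v F"
  shows "x \<in> interior Q"
proof (cases "y = v F")
  case True
  then have "x = y" using assms by (simp add: algebra_simps)
  then show ?thesis using assms by simp
next
  case False
  then have "x \<in> open_segment y (v F)" using assms by (auto simp: in_segment)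
  moreover have "open_segment y (v F) \<subseteq> interior Q"
    using in_interior_closure_convex_segment[OF convex_Q assms(2)] apex_in_Q[OF assms(1)]
      closure_subset by blast
  ultimately show ?thesis by blast
qed

text \<open>A small step from \<open>x\<close> away from \<open>v F\<close> enters the interior of
  \<open>P\<close>: the height of \<open>F\<close> becomes negative and the others stay so. Hence
  \<open>x\<close> lies strictly between an interior point of \<open>P\<close> and
  \<open>v F\<close>.\<close>

lemma near_facet:
  assumes F: "F \<in> facets P" and x: "x \<in> affine hull F"
    and neg: "\<And>G. G \<in> facets P \<Longrightarrow> G \<noteq> F \<Longrightarrow> height P G x < 0"
  shows "x \<in> interior Q"
proof -
  \<comment> \<open>The parameter \<open>- s\<close> continues the line from \<open>v F\<close> past
    \<open>x\<close>, written so that \<open>height_segment\<close> applies.\<close>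
  have h: "height P G ((1 - (- s)) *\<^sub>R x + (- s) *\<^sub>R v F) =
      height P G x + s * (height P G x - height P G (v F))" if "G \<in> facets P" for G s
    using height_segment[OF that, of "- s" x "v F"] by (simp add: algebra_simps)
  have ev: "eventually (\<lambda>s. height P G ((1 - (- s)) *\<^sub>R x + (- s) *\<^sub>R v F) < 0) (at_right 0)"
    if G: "G \<in> facets P" for G
  proof (cases "G = F")
    case True
    have "eventually (\<lambda>s::real. 0 < s) (at_right 0)" by (simp add: eventually_at_right_less)
    then show ?thesis
    proof eventually_elim
      case (elim s)
      then have "s * height P F (v F) > 0" using height_apex[OF F] by simp
      then show ?case using h[OF G, of s] height_zero_iff[OF F, of x] x True by (simp add: algebra_simps)
    qed
  next
    case False
    have "((\<lambda>s. height P G x + s * (height P G x - height P G (v F))) \<longlongrightarrow>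
        height P G x + 0 * (height P G x - height P G (v F))) (at_right 0)"
      by (intro tendsto_intros)
    then have "eventually (\<lambda>s. height P G x + s * (height P G x - height P G (v F)) < 0) (at_right 0)"
      using neg[OF G False] by (intro order_tendstoD(2)) auto
    then show ?thesis using h[OF G] by simp
  qed
  have "eventually (\<lambda>s. \<forall>G \<in> facets P. height P G ((1 - (- s)) *\<^sub>R x + (- s) *\<^sub>R v F) < 0) (at_right (0::real))"
    using ev finite_facets by (simp add: eventually_ball_finite)
  moreover have "eventually (\<lambda>s::real. 0 < s) (at_right 0)" by (simp add: eventually_at_right_less)
  ultimately have "eventually (\<lambda>s. 0 < s \<and> (\<forall>G \<in> facets P. height P G ((1 - (- s)) *\<^sub>R x + (- s) *\<^sub>R v F) < 0)) (at_right (0::real))"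
    by eventually_elim blast
  then obtain s where s: "0 < s" "(1 - (- s)) *\<^sub>R x + (- s) *\<^sub>R v F \<in> interior P"
    unfolding interior_iff using eventually_happens[of _ "at_right (0::real)"]
    by (metis (no_types, lifting) trivial_limit_at_right_real)
  define y where "y = (1 - (- s)) *\<^sub>R x + (- s) *\<^sub>R v F"
  \<comment> \<open>The weight of \<open>v F\<close> when
    \<open>y = (1 + s) *\<^sub>R x - s *\<^sub>R v F\<close> is solved for \<open>x\<close>.\<close>
  define u where "u = s / (1 + s)"
  have u: "0 < u" "u < 1" "(1 - u) * (1 + s) = 1" "u = (1 - u) * s"
    using s by (auto simp: u_def divide_simps)
  have "(1 - u) *\<^sub>R y = ((1 - u) * (1 + s)) *\<^sub>R x - ((1 - u) * s) *\<^sub>R v F"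
    by (simp add: y_def scaleR_diff_right)
  then have "x = (1 - u) *\<^sub>R y + u *\<^sub>R v F" using u by simp
  then show ?thesis
    using open_segment_apex[OF F _ u(1,2)] s interior_P_subset unfolding y_def by blast
qed

text \<open>The ridge functional vanishes on \<open>F \<inter> F'\<close> and at \<open>v F\<close>; it is nonpositive on the other
  generators of \<open>Q\<close>, because it is a positive combination of the two heights.\<close>

definition ridge_functional where
  "ridge_functional F F' x = height P F (v F) * height P F' x - height P F' (v F) * height P F x"

text \<open>The covering step, used in contrapositive form: every boundary point of \<open>Q\<close>
  other than an apex has a nonnegative ridge functional.\<close>

lemma interior_Q:
  assumes x: "x \<in> Q" "x \<notin> v ` facets P"
    and neg: "\<And>F F'. adjacent P F F' \<Longrightarrow> ridge_functional F F' x < 0"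
  shows "x \<in> interior Q"
proof (cases "x \<in> interior P")
  case True
  then show ?thesis using interior_P_subset by blast
next
  case False
  then obtain F where F: "F \<in> facets P" and pos: "height P F x \<ge> 0" using notin_interior_imp by metis
  obtain a b where ab: "height P F = (\<lambda>x. a \<bullet> x - b)"
    using height[OF F] by (auto simp: facet_functional_def)
  \<comment> \<open>Otherwise \<open>x\<close> would maximise the height of \<open>F\<close> over
    \<open>Q\<close>, where \<open>v F\<close> is the only maximiser. Strictness permits the
    division by \<open>1 - s\<close> below.\<close>
  have lt: "height P F x < height P F (v F)"
  proof (rule ccontr)
    assume nlt: "\<not> ?thesis"
    have le: "a \<bullet> y \<le> a \<bullet> v F" and eq: "a \<bullet> y = a \<bullet> v F \<Longrightarrow> y = v F"
      if y: "y \<in> P \<union> v ` facets P" for y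
    proof -
      have "height P F y \<le> 0" if "y \<noteq> v F"
        using y that height_nonpos[OF F] height_other F by (auto intro: less_imp_le)
      then have "y \<noteq> v F \<Longrightarrow> a \<bullet> y < a \<bullet> v F" using height_apex[OF F] ab by force
      then show "a \<bullet> y \<le> a \<bullet> v F" "a \<bullet> y = a \<bullet> v F \<Longrightarrow> y = v F" by (cases "y = v F"; force)+
    qed
    have "(P \<union> v ` facets P) \<inter> {x. a \<bullet> x = a \<bullet> v F} = {v F}"
      using eq F by auto
    then have *: "Q \<inter> {x. a \<bullet> x = a \<bullet> v F} = {v F}"
      using convex_hull_Int_hyperplane[OF compact_generators, of a "a \<bullet> v F"] le by (simp add: Q_def)
    have "Q \<subseteq> {x. a \<bullet> x \<le> a \<bullet> v F}"
      unfolding Q_def using le by (intro hull_minimal) (auto simp: convex_halfspace_le)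
    then have "x = v F" using x nlt * ab by force
    then show False using x F by blast
  qed
  \<comment> \<open>Chosen so that \<open>y\<close>, the projection of \<open>x\<close> from
    \<open>v F\<close>, has height zero over \<open>F\<close>.\<close>
  define s where "s = height P F x / height P F (v F)"
  have s: "0 \<le> s" "s < 1" using pos lt height_apex[OF F] by (auto simp: s_def)
  define y where "y = (1 / (1 - s)) *\<^sub>R (x - s *\<^sub>R v F)"
  have xy: "x = (1 - s) *\<^sub>R y + s *\<^sub>R v F" using s by (simp add: y_def)
  have hx: "height P G x = (1 - s) * height P G y + s * height P G (v F)" if "G \<in> facets P" for G
    using height_segment[OF that] xy by metis
  have "(1 - s) * height P F y = 0"
    using hx[OF F] height_apex[OF F] by (simp add: s_def)
  then have hy: "height P F y = 0" using s by auto
  have "height P G y < 0" if G: "G \<in> facets P" "G \<noteq> F" for G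
  proof (rule rel_interior_facet[OF F _ _ G])
    show "y \<in> affine hull F" using hy height_zero_iff F by blast
    fix F' assume adj: "adjacent P F F'"
    then have F': "F' \<in> facets P" by (simp add: adjacent_def)
    have "ridge_functional F F' x < 0" by (rule neg[OF adj])
    \<comment> \<open>The \<open>v F\<close> part drops out because the ridge functional vanishes
      there, and in the \<open>y\<close> part only the height of \<open>F'\<close> survives.\<close>
    moreover have "ridge_functional F F' x = (1 - s) * (height P F (v F) * height P F' y)"
      unfolding ridge_functional_def hx[OF F] hx[OF F'] hy by (simp add: algebra_simps)
    ultimately show "height P F' y < 0"
      using s height_apex[OF F] by (simp add: mult_less_0_iff)
  qed
  then have y: "y \<in> interior Q"
    using near_facet[OF F] hy height_zero_iff F by blast
  show ?thesis
  proof (cases "s = 0")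
    case True
    then show ?thesis using xy y by simp
  next
    case False
    then show ?thesis using open_segment_apex[OF F y _ _ xy] s by simp
  qed
qed

text \<open>A common zero of two affine functions on a segment makes the determinant of their end
  values vanish, and that determinant is \<open>ridge_functional F F' (v F')\<close>. Conversely,
  the height of \<open>F\<close> changes sign, and at its zero the vanishing determinant forces the
  height of \<open>F'\<close> to be zero too.\<close>

lemma segment_meets_iff:
  assumes F: "F \<in> facets P" "F' \<in> facets P" "F \<noteq> F'"
  shows "(\<exists>x \<in> closed_segment (v F) (v F'). x \<in> affine hull F \<and> x \<in> affine hull F') \<longleftrightarrow>
    ridge_functional F F' (v F') = 0"
proof -
  let ?\<alpha> = "height P F (v F)" and ?\<gamma> = "height P F (v F')"
    and ?\<beta> = "height P F' (v F)" and ?\<delta> = "height P F' (v F')"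
  have pos: "?\<alpha> > 0" "?\<gamma> < 0" using height_apex height_other F by auto
  note hs = height_segment[OF F(1)] height_segment[OF F(2)]
  note hz = height_zero_iff[OF F(1)] height_zero_iff[OF F(2)]
  show ?thesis
  proof
    assume "\<exists>x \<in> closed_segment (v F) (v F'). x \<in> affine hull F \<and> x \<in> affine hull F'"
    then obtain t where t: "(1 - t) * ?\<alpha> + t * ?\<gamma> = 0" "(1 - t) * ?\<beta> + t * ?\<delta> = 0"
      unfolding closed_segment_def by (auto simp flip: hz simp: hs)
    have "?\<alpha> * ?\<delta> - ?\<beta> * ?\<gamma> =
       ?\<delta> * ((1 - t) * ?\<alpha> + t * ?\<gamma>) - ?\<gamma> * ((1 - t) * ?\<beta> + t * ?\<delta>)
       + ?\<alpha> * ((1 - t) * ?\<beta> + t * ?\<delta>) - ?\<beta> * ((1 - t) * ?\<alpha> + t * ?\<gamma>)"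
      by (simp add: algebra_simps)
    then show "ridge_functional F F' (v F') = 0" using t by (simp add: ridge_functional_def)
  next
    assume "ridge_functional F F' (v F') = 0"
    then have eq: "?\<alpha> * ?\<delta> = ?\<beta> * ?\<gamma>" by (simp add: ridge_functional_def)
    obtain s where s: "0 < s" "s < 1" "(1 - s) * ?\<gamma> + s * ?\<alpha> = 0" using segment_zero pos by metis
    have "?\<alpha> * (s * ?\<beta> + (1 - s) * ?\<delta>) = ?\<beta> * ((1 - s) * ?\<gamma> + s * ?\<alpha>)"
      using eq by (simp add: algebra_simps)
    then have "s * ?\<beta> + (1 - s) * ?\<delta> = 0" using s pos by simp
    then have "(1 - (1 - s)) *\<^sub>R v F + (1 - s) *\<^sub>R v F' \<in> affine hull F \<inter> affine hull F'"
      using s hs[of "1 - s" "v F" "v F'"] by (simp flip: hz add: add.commute)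
    moreover have "(1 - (1 - s)) *\<^sub>R v F + (1 - s) *\<^sub>R v F' \<in> closed_segment (v F) (v F')"
      using s unfolding closed_segment_def by (intro CollectI exI[of _ "1 - s"]) simp
    ultimately show "\<exists>x \<in> closed_segment (v F) (v F'). x \<in> affine hull F \<and> x \<in> affine hull F'" by blast
  qed
qed

definition bipyramid where
  "bipyramid F F' = convex hull (F \<inter> F' \<union> {v F, v F'})"

end

section \<open>The face lattice of the convex hull\<close>

context full_polytope
begin

lemma ridge_nonempty: "R ridge_of P \<Longrightarrow> DIM('a) \<ge> 2 \<Longrightarrow> R \<noteq> {}"
  using full by (auto simp: ridge_of_def)

lemma adjacent_exists:
  assumes F: "F \<in> facets P" and "DIM('a) \<ge> 2"
  obtains F' where "adjacent P F F'"
proof -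
  have "polytope F" using face_of_polytope_polytope[OF polytope facet_face[OF F]] .
  moreover have "0 < aff_dim F" using facet_aff_dim[OF F] assms by simp
  ultimately obtain R where "R facet_of F" using polytope_facet_exists by blast
  then show thesis using facet_of_facet[OF F] that by blast
qed

text \<open>The facets of the polytope \<open>F\<close> are exactly its ridges
  \<open>F \<inter> F'\<close> in \<open>P\<close>, so the representation of a face of
  \<open>F\<close> by facets of \<open>F\<close> becomes one by ridges.\<close>

lemma face_eq_Inter_ridges:
  assumes F: "F \<in> facets P" and G: "G face_of P" "G \<subseteq> F" "G \<noteq> {}" "G \<noteq> F"
  shows "G = \<Inter>{F \<inter> F' | F'. adjacent P F F' \<and> G \<subseteq> F'}"
    and "\<exists>F'. adjacent P F F' \<and> G \<subseteq> F'"
proof -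
  have "polyhedron F"
    using face_of_polyhedron_polyhedron[OF polyhedron facet_face[OF F]] .
  moreover have GF: "G face_of F" using face_of_subset[OF G(1,2) facet_subset[OF F]] .
  ultimately have eq: "G = \<Inter>{R. R facet_of F \<and> G \<subseteq> R}"
    by (intro face_of_polyhedron G)
  have "G \<subseteq> F" "G \<noteq> F" using G by auto
  \<comment> \<open>An empty family would have the intersection \<open>UNIV\<close>.\<close>
  then have "G \<noteq> UNIV" by blast
  with eq have "{R. R facet_of F \<and> G \<subseteq> R} \<noteq> {}" by (metis Inter_empty)
  then obtain R where "R facet_of F" "G \<subseteq> R" by blast
  moreover then obtain F' where "adjacent P F F'" "R = F \<inter> F'" by (elim facet_of_facet[OF F])
  ultimately show "\<exists>F'. adjacent P F F' \<and> G \<subseteq> F'" by (intro exI[of _ F']) simp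
  have "{F \<inter> F' | F'. adjacent P F F' \<and> G \<subseteq> F'} = {R. R facet_of F \<and> G \<subseteq> R}"
  proof (intro equalityI subsetI)
    fix R assume "R \<in> {F \<inter> F' | F'. adjacent P F F' \<and> G \<subseteq> F'}"
    then obtain F' where F': "adjacent P F F'" "G \<subseteq> F'" "R = F \<inter> F'" by blast
    then have "R face_of P" "aff_dim R = aff_dim P - 2" "R \<noteq> {}"
      by (auto simp: adjacent_def ridge_of_def)
    moreover have "R face_of F"
      using \<open>R face_of P\<close> F' facet_subset[OF F] face_of_subset by (metis inf_le1)
    ultimately have "R facet_of F" using facet_aff_dim[OF F] full by (auto simp: facet_of_def)
    then show "R \<in> {R. R facet_of F \<and> G \<subseteq> R}" using F' G by blast
  next
    fix R assume R: "R \<in> {R. R facet_of F \<and> G \<subseteq> R}"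
    then obtain F' where "adjacent P F F'" "R = F \<inter> F'" using facet_of_facet[OF F] by blast
    then show "R \<in> {F \<inter> F' | F'. adjacent P F F' \<and> G \<subseteq> F'}" using R by blast
  qed
  then show "G = \<Inter>{F \<inter> F' | F'. adjacent P F F' \<and> G \<subseteq> F'}" using eq by simp
qed

text \<open>A face of codimension at least 2 is not a facet, so its representation as an
  intersection of facets has at least two members.\<close>

lemma two_facets_containing:
  assumes G: "G face_of P" "G \<noteq> {}" "aff_dim G \<le> int DIM('a) - 2"
  obtains F F' where "F \<in> facets P" "F' \<in> facets P" "F \<noteq> F'" "G \<subseteq> F" "G \<subseteq> F'"
proof -
  have "G \<noteq> P" using G full by auto
  then have eq: "G = \<Inter>{F. F facet_of P \<and> G \<subseteq> F}"
    using face_of_polyhedron[OF polyhedron G(1,2)] by blast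
  have "G \<noteq> UNIV" using \<open>G \<noteq> P\<close> G(1) face_of_imp_subset by blast
  with eq have "{F. F facet_of P \<and> G \<subseteq> F} \<noteq> {}" by (metis Inter_empty)
  then obtain F where F: "F \<in> facets P" "G \<subseteq> F" by (auto simp: facets_def)
  have "G \<noteq> F" using facet_aff_dim[OF F(1)] G by auto
  then have "{F. F facet_of P \<and> G \<subseteq> F} \<noteq> {F}" using eq by (metis cInf_singleton)
  then obtain F' where "F' \<in> facets P" "G \<subseteq> F'" "F' \<noteq> F"
    using F unfolding facets_def by blast
  then show thesis using that F by blast
qed

end

locale stellar_realisation = stellar P v for P :: "'a::euclidean_space set" and v +
  assumes apices: "apices P v" and dim: "DIM('a) \<ge> 2"
begin

lemma ridge_functional_opposite: "adjacent P F F' \<Longrightarrow> ridge_functional F F' (v F') = 0"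
  using apices segment_meets_iff unfolding apices_def adjacent_def by metis

text \<open>Both coefficients \<open>height P F (v F)\<close> and \<open>- height P F' (v F)\<close>
  are positive, so on \<open>P\<close> the value is zero only where both heights vanish. Among the
  apices it is zero at \<open>v F\<close> identically, at \<open>v F'\<close> by
  \<open>apices\<close>, and negative elsewhere.\<close>

lemma ridge_functional_generators:
  assumes adj: "adjacent P F F'"
  shows "x \<in> P \<Longrightarrow> ridge_functional F F' x \<le> 0"
    and "x \<in> P \<Longrightarrow> ridge_functional F F' x = 0 \<longleftrightarrow> x \<in> F \<inter> F'"
    and "G \<in> facets P \<Longrightarrow> ridge_functional F F' (v G) \<le> 0"
    and "G \<in> facets P \<Longrightarrow> ridge_functional F F' (v G) = 0 \<longleftrightarrow> G \<in> {F, F'}"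
proof -
  have F: "F \<in> facets P" "F' \<in> facets P" "F \<noteq> F'" using adj by (auto simp: adjacent_def)
  have pos: "height P F (v F) > 0" "- height P F' (v F) > 0"
    using height_apex height_other F by auto
  have rf: "ridge_functional F F' x = height P F (v F) * height P F' x + (- height P F' (v F)) * height P F x" for x
    by (simp add: ridge_functional_def)
  show "ridge_functional F F' x \<le> 0" "ridge_functional F F' x = 0 \<longleftrightarrow> x \<in> F \<inter> F'" if x: "x \<in> P"
  proof -
    have h: "height P F (v F) * height P F' x \<le> 0" "(- height P F' (v F)) * height P F x \<le> 0"
      using pos height_nonpos x F by (meson less_imp_le mult_nonneg_nonpos)+
    then show "ridge_functional F F' x \<le> 0" using rf by simp
    have "ridge_functional F F' x = 0 \<longleftrightarrow> height P F x = 0 \<and> height P F' x = 0"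
      using h pos unfolding rf by (smt (verit) mult_eq_0_iff)
    also have "\<dots> \<longleftrightarrow> x \<in> F \<inter> F'"
      using height_facet[OF F(1)] height_zero_imp[OF F(1) x] height_facet[OF F(2)] height_zero_imp[OF F(2) x]
      by auto
    finally show "ridge_functional F F' x = 0 \<longleftrightarrow> x \<in> F \<inter> F'" .
  qed
  have neg: "ridge_functional F F' (v G) < 0" if "G \<in> facets P" "G \<notin> {F, F'}" for G
    unfolding rf using pos height_other that F by (intro add_neg_neg mult_pos_neg) auto
  have zero: "ridge_functional F F' (v F) = 0" "ridge_functional F F' (v F') = 0"
    using ridge_functional_opposite[OF adj] by (simp_all add: ridge_functional_def)
  show "ridge_functional F F' (v G) \<le> 0" "ridge_functional F F' (v G) = 0 \<longleftrightarrow> G \<in> {F, F'}"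
    if "G \<in> facets P"
  proof -
    have "G = F \<or> G = F' \<or> G \<notin> {F, F'}" by blast
    then show "ridge_functional F F' (v G) \<le> 0" "ridge_functional F F' (v G) = 0 \<longleftrightarrow> G \<in> {F, F'}"
      using neg[OF that] zero by (metis insertCI less_eq_real_def less_irrefl)+
  qed
qed

lemma bipyramid_eq:
  assumes adj: "adjacent P F F'"
  shows "bipyramid F F' = Q \<inter> {x. ridge_functional F F' x = 0}" (is ?eq)
    and "bipyramid F F' face_of Q"
    and "Q \<subseteq> {x. ridge_functional F F' x \<le> 0}" (is ?sub)
proof -
  have F: "F \<in> facets P" "F' \<in> facets P" "F \<noteq> F'" using adj by (auto simp: adjacent_def)
  obtain a1 b1 a2 b2 where ab: "height P F = (\<lambda>x. a1 \<bullet> x - b1)" "height P F' = (\<lambda>x. a2 \<bullet> x - b2)"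
    using height F unfolding facet_functional_def by metis
  define a where "a = height P F (v F) *\<^sub>R a2 - height P F' (v F) *\<^sub>R a1"
  define b where "b = height P F (v F) * b2 - height P F' (v F) * b1"
  have rf: "ridge_functional F F' x = a \<bullet> x - b" for x
  proof -
    have "ridge_functional F F' x = height P F (v F) * (a2 \<bullet> x - b2) - height P F' (v F) * (a1 \<bullet> x - b1)"
      by (simp only: ridge_functional_def fun_cong[OF ab(1), of x] fun_cong[OF ab(2), of x])
    also have "\<dots> = a \<bullet> x - b" by (simp add: a_def b_def inner_diff_left algebra_simps)
    finally show ?thesis .
  qed
  let ?S = "P \<union> v ` facets P"
  have le: "a \<bullet> x \<le> b" if "x \<in> ?S" for x
    using ridge_functional_generators(1,3)[OF adj] that by (auto simp: rf)
  have "?S \<inter> {x. a \<bullet> x = b} = F \<inter> F' \<union> {v F, v F'}"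
    using ridge_functional_generators(2,4)[OF adj] F facet_subset[of F] by (auto simp: rf)
  then have "Q \<inter> {x. a \<bullet> x = b} = bipyramid F F'" "(Q \<inter> {x. a \<bullet> x = b}) face_of Q"
    using convex_hull_Int_hyperplane[OF compact_generators le] by (simp_all add: Q_def bipyramid_def)
  then show ?eq "bipyramid F F' face_of Q" by (simp_all add: rf)
  have "Q \<subseteq> {x. a \<bullet> x \<le> b}"
    unfolding Q_def using le by (intro hull_minimal) (auto simp: convex_halfspace_le)
  then show ?sub by (auto simp: rf)
qed

lemma bipyramid_Int_P:
  assumes adj: "adjacent P F F'"
  shows "bipyramid F F' \<inter> P = F \<inter> F'"
proof -
  have "F \<inter> F' \<subseteq> P" using adj facet_subset[of F] by (auto simp: adjacent_def)
  moreover have "x \<in> bipyramid F F' \<longleftrightarrow> x \<in> F \<inter> F'" if "x \<in> P" for x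
    using that P_subset_Q ridge_functional_generators(2)[OF adj that] by (auto simp: bipyramid_eq(1)[OF adj])
  ultimately show ?thesis by blast
qed

lemma apex_in_bipyramid_iff:
  assumes "adjacent P F F'" "G \<in> facets P"
  shows "v G \<in> bipyramid F F' \<longleftrightarrow> G = F \<or> G = F'"
  unfolding bipyramid_eq(1)[OF assms(1)]
  using ridge_functional_generators(4)[OF assms] apex_in_Q[OF assms(2)] by simp

text \<open>The ridge together with \<open>v F\<close> already spans dimension d - 1, and the trace
  on \<open>P\<close> shows that the face is proper.\<close>

lemma bipyramid_facet:
  assumes adj: "adjacent P F F'"
  shows "bipyramid F F' \<in> facets Q"
proof -
  have F: "F \<in> facets P" "F' \<in> facets P" "F \<noteq> F'" and R: "aff_dim (F \<inter> F') = int DIM('a) - 2"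
    using adj full by (auto simp: adjacent_def ridge_of_def)
  have "v F \<notin> affine hull (F \<inter> F')"
    using height_zero_iff[OF F(1)] height_apex[OF F(1)] hull_mono[of "F \<inter> F'" F affine] by force
  then have "aff_dim (insert (v F) (F \<inter> F')) = int DIM('a) - 1"
    using R by (simp add: aff_dim_insert)
  moreover have "insert (v F) (F \<inter> F') \<subseteq> bipyramid F F'"
    unfolding bipyramid_def using hull_subset by fastforce
  ultimately have "aff_dim (bipyramid F F') \<ge> int DIM('a) - 1"
    using aff_dim_subset by metis
  moreover have "bipyramid F F' \<noteq> Q"
  proof
    assume "bipyramid F F' = Q"
    then have "F \<inter> F' = P" using bipyramid_Int_P[OF adj] P_subset_Q by blast
    then show False using R full by simp
  qed
  then have "aff_dim (bipyramid F F') < int DIM('a)"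
    using face_of_aff_dim_lt[OF convex_Q bipyramid_eq(2)[OF adj]] aff_dim_Q by simp
  ultimately have "aff_dim (bipyramid F F') = int DIM('a) - 1" by linarith
  moreover from this have "bipyramid F F' \<noteq> {}" using dim by force
  ultimately show ?thesis
    using bipyramid_eq(2)[OF adj] aff_dim_Q by (simp add: facets_def facet_of_def)
qed

text \<open>A relative interior point of a facet is a boundary point of \<open>Q\<close> and so lies
  on a bipyramid; a face through such a point contains the whole facet.\<close>

lemma facets_Q: "facets Q = {bipyramid F F' | F F'. adjacent P F F'}"
proof (intro equalityI subsetI)
  interpret Q: full_polytope Q by (rule full_polytope_Q)
  fix K assume K: "K \<in> facets Q"
  have "rel_interior K \<noteq> {}"
    using rel_interior_eq_empty[OF Q.facet_convex[OF K]] Q.facet_nonempty[OF K] by simp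
  then obtain x where x: "x \<in> rel_interior K" by blast
  then have xQ: "x \<in> Q" using rel_interior_subset Q.facet_subset[OF K] by blast
  have "K \<noteq> Q" using Q.facet_aff_dim[OF K] aff_dim_Q by auto
  then have "x \<notin> interior Q"
    using face_of_disjoint_interior[OF Q.facet_face[OF K]] x rel_interior_subset by blast
  have "\<exists>F F'. adjacent P F F' \<and> x \<in> bipyramid F F'"
  proof (cases "x \<in> v ` facets P")
    \<comment> \<open>Apices are outside the scope of \<open>interior_Q\<close>; each lies on a
      bipyramid because for d at least 2 every facet has a neighbour.\<close>
    case True
    then obtain F where F: "F \<in> facets P" "x = v F" by blast
    then obtain F' where "adjacent P F F'" using adjacent_exists dim by blast
    then show ?thesis using F apex_in_bipyramid_iff by blast
  next
    case False
    then obtain F F' where adj: "adjacent P F F'" "\<not> ridge_functional F F' x < 0"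
      using interior_Q[OF xQ False] \<open>x \<notin> interior Q\<close> by blast
    moreover have "ridge_functional F F' x \<le> 0" using bipyramid_eq(3)[OF adj(1)] xQ by blast
    ultimately have "x \<in> bipyramid F F'" using bipyramid_eq(1)[OF adj(1)] xQ by auto
    then show ?thesis using adj by blast
  qed
  then obtain F F' where adj: "adjacent P F F'" "x \<in> bipyramid F F'" by blast
  then have "K \<subseteq> bipyramid F F'"
    using subset_of_face_of[OF bipyramid_eq(2)[OF adj(1)] Q.facet_subset[OF K]] x by blast
  then have "K = bipyramid F F'"
    using Q.facet_subset_eq K bipyramid_facet[OF adj(1)] by blast
  then show "K \<in> {bipyramid F F' | F F'. adjacent P F F'}" using adj by blast
next
  fix K assume "K \<in> {bipyramid F F' | F F'. adjacent P F F'}"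
  then obtain F F' where "adjacent P F F'" "K = bipyramid F F'" by (elim CollectE exE conjE)
  then show "K \<in> facets Q" using bipyramid_facet by simp
qed

section \<open>The isomorphism of face lattices\<close>

definition face_data where
  "face_data K = (K \<inter> P, {F \<in> facets P. v F \<in> K})"

text \<open>Makes \<open>face_data\<close> injective and order reflecting: a face of a hull is the
  hull of the generators in it.\<close>

lemma face_eq_hull:
  assumes "K face_of Q"
  shows "K = convex hull (K \<inter> P \<union> v ` {F \<in> facets P. v F \<in> K})"
proof
  obtain S where S: "S \<subseteq> P \<union> v ` facets P" "K = convex hull S"
    using assms unfolding Q_def by (rule face_of_convex_hull_subset[OF compact_generators])
  then have "S \<subseteq> K \<inter> P \<union> v ` {F \<in> facets P. v F \<in> K}" using hull_subset[of S convex] by blast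
  then show "K \<subseteq> convex hull (K \<inter> P \<union> v ` {F \<in> facets P. v F \<in> K})"
    using S(2) hull_mono by blast
  show "convex hull (K \<inter> P \<union> v ` {F \<in> facets P. v F \<in> K}) \<subseteq> K"
    using face_of_imp_convex[OF assms] by (intro hull_minimal) auto
qed

lemma face_data_le:
  assumes "K face_of Q" "L face_of Q"
  shows "K \<subseteq> L \<longleftrightarrow> E_le (face_data K) (face_data L)"
proof
  assume "E_le (face_data K) (face_data L)"
  then have "K \<inter> P \<union> v ` {F \<in> facets P. v F \<in> K} \<subseteq> L \<inter> P \<union> v ` {F \<in> facets P. v F \<in> L}"
    by (auto simp: E_le_def face_data_def)
  then have sub: "convex hull (K \<inter> P \<union> v ` {F \<in> facets P. v F \<in> K}) \<subseteq>
      convex hull (L \<inter> P \<union> v ` {F \<in> facets P. v F \<in> L})"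
    by (rule hull_mono)
  show "K \<subseteq> L"
    by (rule ord_eq_le_trans[OF face_eq_hull[OF assms(1)]],
        rule ord_le_eq_trans[OF sub face_eq_hull[OF assms(2), symmetric]])
qed (auto simp: E_le_def face_data_def)

lemma face_data_Q: "face_data Q = (P, facets P)"
  using P_subset_Q apex_in_Q by (auto simp: face_data_def)

lemma face_data_empty: "face_data {} = ({}, {})"
  by (auto simp: face_data_def)

lemma face_data_apex:
  assumes "F \<in> facets P"
  shows "face_data {v F} = ({}, {F})"
proof -
  have "{v F} \<inter> P = {}" using apex_notin[OF assms] by blast
  moreover have "{G \<in> facets P. v G \<in> {v F}} = {F}"
    using inj_onD[OF apex_inj] assms by blast
  ultimately show ?thesis by (simp add: face_data_def)
qed

lemma face_data_bipyramid:
  assumes "adjacent P F F'"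
  shows "face_data (bipyramid F F') = (F \<inter> F', {F, F'})"
proof -
  have "{G \<in> facets P. v G \<in> bipyramid F F'} = {F, F'}"
    using apex_in_bipyramid_iff[OF assms] assms unfolding adjacent_def by blast
  then show ?thesis using bipyramid_Int_P[OF assms] by (simp add: face_data_def)
qed

text \<open>A proper nonempty face is a bipyramid or lies in two different ones. In the second case
  its trace on \<open>P\<close> lies in two distinct ridges, so its dimension is at most d - 3, and
  two distinct pairs of facets have at most one apex in common.\<close>

lemma face_data_in_E_faces:
  assumes K: "K face_of Q"
  shows "face_data K \<in> E_faces P"
proof -
  interpret Q: full_polytope Q by (rule full_polytope_Q)
  have KP: "K \<inter> P face_of P"
    using face_of_slice[OF K convex] P_subset_Q by (simp add: Int_absorb1)
  consider "K = Q" | "K = {}" | "K \<noteq> Q" "K \<noteq> {}" by blast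
  then show ?thesis
  proof cases
    case 1
    then show ?thesis by (simp add: face_data_Q E_faces_def)
  next
    case 2
    \<comment> \<open>The empty face has \<open>aff_dim\<close> equal to -1, which is at most d - 3
      because d is at least 2.\<close>
    then show ?thesis using dim full by (simp add: face_data_empty E_faces_def)
  next
    case 3
    then have eq: "K = \<Inter>{B. B facet_of Q \<and> K \<subseteq> B}"
      using face_of_polyhedron[OF Q.polyhedron K] by blast
    have "K \<noteq> UNIV" using 3 K face_of_imp_subset by blast
    with eq have "{B. B facet_of Q \<and> K \<subseteq> B} \<noteq> {}" by (metis Inter_empty)
    then obtain B where B: "B \<in> facets Q" "K \<subseteq> B" by (auto simp: facets_def)
    then obtain F F' where adj: "adjacent P F F'" and BF: "B = bipyramid F F'" using facets_Q by auto
    have FF: "F \<inter> F' ridge_of P" "F \<inter> F' \<noteq> {}" "F \<in> facets P" "F' \<in> facets P" "F \<noteq> F'"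
      using adj by (auto simp: adjacent_def)
    show ?thesis
    proof (cases "K = B")
      case True
      then have "face_data K = (F \<inter> F', {G \<in> facets P. F \<inter> F' \<subseteq> G})"
        using face_data_bipyramid[OF adj] facets_of_ridge[OF FF] BF by simp
      then show ?thesis using FF(1) by (auto simp: E_faces_def)
    next
      case False
      then have "{B. B facet_of Q \<and> K \<subseteq> B} \<noteq> {B}" using eq by (metis cInf_singleton)
      then obtain B' where B': "B' \<in> facets Q" "K \<subseteq> B'" "B' \<noteq> B"
        using B unfolding facets_def by blast
      then obtain G G' where adj': "adjacent P G G'" and BG: "B' = bipyramid G G'" using facets_Q by auto
      have GG: "G \<inter> G' ridge_of P" "G \<inter> G' \<noteq> {}" "G \<in> facets P" "G' \<in> facets P" "G \<noteq> G'"
        using adj' by (auto simp: adjacent_def)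
      \<comment> \<open>A ridge determines its two facets and hence its bipyramid.\<close>
      have ne: "F \<inter> F' \<noteq> G \<inter> G'"
      proof
        assume eqR: "F \<inter> F' = G \<inter> G'"
        then have "{F, F'} = {G, G'}" using facets_of_ridge[OF FF] facets_of_ridge[OF GG] by simp
        then have "v ` {F, F'} = v ` {G, G'}" by (rule arg_cong)
        then have "bipyramid F F' = bipyramid G G'" unfolding bipyramid_def eqR by simp
        then show False using B' BF BG by simp
      qed
      have ne': "{F, F'} \<noteq> {G, G'}" using ne by (auto simp: doubleton_eq_iff)
      have sub: "K \<inter> P \<subseteq> F \<inter> F' \<inter> (G \<inter> G')"
        using B B' BF BG bipyramid_Int_P[OF adj] bipyramid_Int_P[OF adj'] by blast
      have faces: "F \<inter> F' face_of P" "G \<inter> G' face_of P"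
        "aff_dim (F \<inter> F') = int DIM('a) - 2" "aff_dim (G \<inter> G') = int DIM('a) - 2"
        using FF GG full by (auto simp: ridge_of_def)
      have "aff_dim (F \<inter> F' \<inter> (G \<inter> G')) < int DIM('a) - 2"
      proof -
        have "F \<inter> F' \<inter> (G \<inter> G') \<noteq> F \<inter> F'"
        proof
          assume "F \<inter> F' \<inter> (G \<inter> G') = F \<inter> F'"
          then have "F \<inter> F' face_of (G \<inter> G')"
            using face_of_subset[OF faces(1), of "G \<inter> G'"] face_of_imp_subset[OF faces(2)] by blast
          then show False
            using face_of_aff_dim_lt[OF face_of_imp_convex[OF faces(2)] _ ne] faces(3,4) by simp
        qed
        moreover have "F \<inter> F' \<inter> (G \<inter> G') face_of F \<inter> F'"
          using face_of_subset[OF face_of_Int[OF faces(1,2)], of "F \<inter> F'"] face_of_imp_subset[OF faces(1)]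
          by blast
        ultimately show ?thesis
          using face_of_aff_dim_lt[OF face_of_imp_convex[OF faces(1)]] faces by metis
      qed
      then have dimK: "aff_dim (K \<inter> P) \<le> aff_dim P - 3"
        using aff_dim_subset[OF sub] full by simp
      have A: "{H \<in> facets P. v H \<in> K} \<subseteq> {F, F'} \<inter> {G, G'}"
        using B B' BF BG apex_in_bipyramid_iff[OF adj] apex_in_bipyramid_iff[OF adj'] by blast
      show ?thesis
      proof (cases "{H \<in> facets P. v H \<in> K} = {}")
        case True
        then show ?thesis using KP dimK by (auto simp: face_data_def E_faces_def)
      next
        case False
        then obtain H where H: "H \<in> facets P" "v H \<in> K" by blast
        then have HF: "H \<in> {F, F'}" "H \<in> {G, G'}" using A by auto
        have "{F, F'} \<inter> {G, G'} \<subseteq> {H}" using HF ne' by auto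
        then have "{H \<in> facets P. v H \<in> K} = {H}" using A H by auto
        moreover have "K \<inter> P \<subseteq> H" using sub HF by blast
        ultimately show ?thesis using H KP dimK
          by (auto simp: face_data_def E_faces_def facets_def)
      qed
    qed
  qed
qed

text \<open>The face is the intersection of the bipyramids over all ridges of \<open>F\<close>
  through \<open>G\<close>. A second apex \<open>v H\<close> common to them would leave the single
  ridge \<open>F \<inter> H\<close>, equal to \<open>G\<close>, against the dimension of
  \<open>G\<close>.\<close>

lemma pyramid_face:
  assumes F: "F \<in> facets P" and G: "G face_of P" "G \<subseteq> F" "aff_dim G \<le> int DIM('a) - 3"
  shows "\<exists>K. K face_of Q \<and> face_data K = (G, {F})"
proof (cases "G = {}")
  case True
  then show ?thesis using apex_face[OF F] face_data_apex[OF F] by blast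
next
  case False
  have "G \<noteq> F" using facet_aff_dim[OF F] G by auto
  note ridges = face_eq_Inter_ridges[OF F G(1,2) False \<open>G \<noteq> F\<close>]
  define N where "N = {F'. adjacent P F F' \<and> G \<subseteq> F'}"
  define K where "K = (\<Inter>F' \<in> N. bipyramid F F')"
  have "N \<noteq> {}" using ridges(2) by (auto simp: N_def)
  have "K face_of Q"
    unfolding K_def using \<open>N \<noteq> {}\<close> bipyramid_eq(2) by (intro face_of_Inter) (auto simp: N_def)
  have "K \<inter> P = (\<Inter>F' \<in> N. bipyramid F F' \<inter> P)" using \<open>N \<noteq> {}\<close> by (auto simp: K_def)
  also have "\<dots> = (\<Inter>F' \<in> N. F \<inter> F')"
    by (rule INF_cong) (auto simp: N_def bipyramid_Int_P)
  also have "(\<Inter>F' \<in> N. F \<inter> F') = \<Inter>{F \<inter> F' | F'. adjacent P F F' \<and> G \<subseteq> F'}"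
    by (rule arg_cong[of _ _ Inter]) (auto simp: N_def)
  also have "\<dots> = G" using ridges(1) by simp
  finally have KP: "K \<inter> P = G" .
  have "v F \<in> K" using apex_in_bipyramid_iff F by (auto simp: K_def N_def)
  moreover have "H = F" if H: "H \<in> facets P" "v H \<in> K" for H
  proof (rule ccontr)
    assume "H \<noteq> F"
    then have "F' = H" if "F' \<in> N" for F'
      using that H apex_in_bipyramid_iff by (auto simp: K_def N_def)
    then have "N = {H}" using \<open>N \<noteq> {}\<close> by blast
    then have adj: "adjacent P F H" by (auto simp: N_def)
    moreover have "G = F \<inter> H"
      using KP bipyramid_Int_P[OF adj] by (simp add: K_def \<open>N = {H}\<close>)
    ultimately show False using G full by (auto simp: adjacent_def ridge_of_def)
  qed
  ultimately have "{H \<in> facets P. v H \<in> K} = {F}" using F by blast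
  then have "face_data K = (G, {F})" using KP by (simp add: face_data_def)
  then show ?thesis using \<open>K face_of Q\<close> by blast
qed

lemma face_data_surj:
  assumes X: "X \<in> E_faces P"
  shows "\<exists>K. K face_of Q \<and> face_data K = X"
proof -
  from X have "(\<exists>G. X = (G, {}) \<and> G face_of P \<and> aff_dim G \<le> aff_dim P - 3) \<or>
        (\<exists>G F. X = (G, {F}) \<and> F facet_of P \<and> G face_of P \<and> G \<subseteq> F \<and> aff_dim G \<le> aff_dim P - 3) \<or>
        (\<exists>R. X = (R, {F \<in> facets P. R \<subseteq> F}) \<and> R ridge_of P) \<or> X = (P, facets P)"
    unfolding E_faces_def Un_iff mem_Collect_eq singleton_iff disj_assoc by assumption
  then show ?thesis
  proof (elim disjE exE conjE)
    fix G assume old: "X = (G, {})" "G face_of P" "aff_dim G \<le> aff_dim P - 3"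
    show ?thesis
    proof (cases "G = {}")
      case True
      then show ?thesis using old face_data_empty by (metis empty_face_of)
    next
      case False
      have dimG: "aff_dim G \<le> int DIM('a) - 3" "aff_dim G \<le> int DIM('a) - 2"
        using old(3) full by auto
      \<comment> \<open>An old face arises as the intersection of two pyramids over it with
        different apices.\<close>
      obtain F F' where F: "F \<in> facets P" "F' \<in> facets P" "F \<noteq> F'" "G \<subseteq> F" "G \<subseteq> F'"
        by (rule two_facets_containing[OF old(2) False dimG(2)])
      obtain K K' where K: "K face_of Q" "face_data K = (G, {F})" "K' face_of Q" "face_data K' = (G, {F'})"
        using pyramid_face[OF F(1) old(2) F(4) dimG(1)] pyramid_face[OF F(2) old(2) F(5) dimG(1)]
        by (elim exE conjE)
      then have "K \<inter> P = G" "K' \<inter> P = G" "{H \<in> facets P. v H \<in> K} = {F}" "{H \<in> facets P. v H \<in> K'} = {F'}"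
        by (simp_all add: face_data_def)
      then have "K \<inter> K' \<inter> P = G" "{H \<in> facets P. v H \<in> K \<inter> K'} = {}" using F(3) by blast+
      then have "face_data (K \<inter> K') = (G, {})" by (simp add: face_data_def)
      then show ?thesis using old(1) K face_of_Int by blast
    qed
  next
    fix G F assume pyr: "X = (G, {F})" "F facet_of P" "G face_of P" "G \<subseteq> F" "aff_dim G \<le> aff_dim P - 3"
    then show ?thesis using pyramid_face[of F G] full by (simp add: facets_def)
  next
    fix R assume bipyr: "X = (R, {F \<in> facets P. R \<subseteq> F})" "R ridge_of P"
    have Rne: "R \<noteq> {}" using ridge_nonempty bipyr dim by blast
    obtain F where "F \<in> facets P" "R \<subseteq> F"
    proof -
      have "R face_of P" "aff_dim R \<le> int DIM('a) - 2" using bipyr(2) full by (auto simp: ridge_of_def)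
      then show thesis using that by (rule two_facets_containing[OF _ Rne])
    qed
    moreover then obtain F' where "F' \<in> facets P" "F' \<noteq> F" "R = F \<inter> F'"
      using ridge_two_facets[OF bipyr(2) Rne] by blast
    ultimately have adj: "adjacent P F F'" and R: "R = F \<inter> F'" using bipyr Rne by (auto simp: adjacent_def)
    then have "{F \<in> facets P. R \<subseteq> F} = {F, F'}" using facets_of_ridge[of F F'] by (auto simp: adjacent_def)
    then have "face_data (bipyramid F F') = X" using face_data_bipyramid[OF adj] bipyr(1) R by simp
    then show ?thesis using bipyramid_eq(2)[OF adj] by blast
  next
    assume top: "X = (P, facets P)"
    then show ?thesis using face_data_Q convex_Q face_of_refl by metis
  qed
qed

lemma polytopal_realisation: "polytopal_realisation_E P Q"
proof -
  have "bij_betw face_data {K. K face_of Q} (E_faces P)"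
    unfolding bij_betw_def
  proof
    show "inj_on face_data {K. K face_of Q}"
    proof (rule inj_onI)
      fix K L assume KL: "K \<in> {K. K face_of Q}" "L \<in> {K. K face_of Q}" "face_data K = face_data L"
      then have "K \<subseteq> L" "L \<subseteq> K" using face_data_le by (auto simp: E_le_def)
      then show "K = L" by blast
    qed
    show "face_data ` {K. K face_of Q} = E_faces P"
      using face_data_in_E_faces face_data_surj by blast
  qed
  then show ?thesis
    unfolding polytopal_realisation_E_def using polytope_Q face_data_le by blast
qed

lemma vertex_preserving: "vertex_preserving_realisation_E P Q"
proof -
  \<comment> \<open>For d at least 2 ridges are nonempty, so \<open>adjacent\<close> agrees with the
    condition that indexes the facets in \<open>vertex_preserving_realisation_E\<close>.\<close>
  have adj: "adjacent P F F' \<longleftrightarrow> F \<inter> F' ridge_of P \<and> F \<in> facets P \<and> F' \<in> facets P \<and> F \<noteq> F'" for F F'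
    using ridge_nonempty[of "F \<inter> F'"] dim unfolding adjacent_def by argo
  have "facets Q = {convex hull (R \<union> {v F, v F'}) | R F F'.
       R ridge_of P \<and> F \<in> facets P \<and> F' \<in> facets P \<and> F \<noteq> F' \<and> R = F \<inter> F'}"
    unfolding facets_Q adj bipyramid_def by (rule Collect_cong) auto
  moreover have "\<forall>F \<in> facets P. beyond P F (v F) \<and> v F \<in> vertices Q"
    using beyond apex_vertex by simp
  moreover have "aff_dim P \<noteq> 1" using dim full by simp
  ultimately show ?thesis
    unfolding vertex_preserving_realisation_E_def if_not_P[OF \<open>aff_dim P \<noteq> 1\<close>]
    by (intro conjI polytopal_realisation exI[of _ v] Q_def)
qed

end

section \<open>Vertex-preserving realisations\<close>

context full_polytope
begin

lemma vertex_preserving_apices: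
  assumes dim: "DIM('a) \<ge> 2" and vp: "vertex_preserving_realisation_E P Q"
  obtains v where "apices P v" "Q = convex hull (P \<union> v ` facets P)"
proof -
  have ne1: "aff_dim P \<noteq> 1" using dim full by simp
  obtain v where v: "\<forall>F \<in> facets P. beyond P F (v F) \<and> v F \<in> vertices Q"
    and Q: "Q = convex hull (P \<union> v ` facets P)"
    and fac: "facets Q = {convex hull (R \<union> {v F, v F'}) | R F F'.
          R ridge_of P \<and> F \<in> facets P \<and> F' \<in> facets P \<and> F \<noteq> F' \<and> R = F \<inter> F'}"
    using vp unfolding vertex_preserving_realisation_E_def if_not_P[OF ne1] by (elim conjE exE)
  interpret s: stellar P v using v by unfold_locales simp
  have sQ: "s.Q = Q" by (simp add: s.Q_def Q)
  interpret Q: full_polytope Q using s.full_polytope_Q sQ by simp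
  have "\<exists>x \<in> closed_segment (v F) (v F'). x \<in> affine hull F \<and> x \<in> affine hull F'"
    if adj: "adjacent P F F'" for F F'
  proof -
    have F: "F \<in> facets P" "F' \<in> facets P" "F \<noteq> F'" "F \<inter> F' ridge_of P" "F \<inter> F' \<noteq> {}"
      using adj by (simp_all add: adjacent_def)
    define B where "B = convex hull (F \<inter> F' \<union> {v F, v F'})"
    have "B \<in> facets Q" unfolding fac B_def using F by blast
    then obtain a b where ab: "a \<noteq> 0" "affine hull B = {y. a \<bullet> y = b}"
      by (rule Q.facet_functional_exists)
    let ?H = "{y. a \<bullet> y = b}"
    have "F \<inter> F' \<union> {v F, v F'} \<subseteq> B" unfolding B_def by (rule hull_subset)
    also have "B \<subseteq> ?H" using hull_subset[of B affine] ab by simp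
    finally have inH: "F \<inter> F' \<subseteq> ?H" "v F \<in> ?H" "v F' \<in> ?H" by blast+
    \<comment> \<open>Otherwise the two hyperplanes would coincide and put \<open>v F\<close> into
      the hull of \<open>F\<close>.\<close>
    have ne: "\<not> affine hull F \<subseteq> ?H"
    proof
      assume sub: "affine hull F \<subseteq> ?H"
      have "affine hull F = ?H"
      proof (rule affine_dim_equal)
        show "aff_dim (affine hull F) = aff_dim ?H"
          using facet_aff_dim[OF F(1)] ab(1) by (simp add: of_nat_diff Suc_leI)
      qed (use sub facet_nonempty[OF F(1)] in \<open>simp_all add: affine_hyperplane\<close>)
      then show False using inH(2) height_zero_iff[OF F(1), of "v F"] s.height_apex[OF F(1)] by simp
    qed
    have RF: "affine hull (F \<inter> F') \<subseteq> affine hull F \<inter> ?H"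
      using inH(1) hull_subset[of F affine] by (intro hull_minimal) (auto simp: affine_Int affine_hyperplane)
    have "affine hull F \<inter> ?H \<noteq> {}" using RF F(5) hull_subset[of "F \<inter> F'" affine] by blast
    then have "aff_dim (affine hull F \<inter> ?H) = aff_dim (affine hull F) - 1"
      using ne aff_dim_affine_Int_hyperplane[of "affine hull F" a b] by simp
    then have "affine hull (F \<inter> F') = affine hull F \<inter> ?H"
      using RF F(4,5) facet_aff_dim[OF F(1)] full
      by (intro affine_dim_equal) (simp_all add: affine_Int affine_hyperplane ridge_of_def)
    then have sub: "affine hull F \<inter> ?H \<subseteq> affine hull F'"
      using hull_mono[of "F \<inter> F'" F' affine] by simp
    \<comment> \<open>The height of \<open>F\<close> changes sign between the apices. The crossing
      point also lies in \<open>?H\<close>, hence in the hull of the ridge.\<close>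
    obtain t where t: "0 < t" "t < 1"
      "(1 - t) * height P F (v F') + t * height P F (v F) = 0"
      using segment_zero s.height_apex[OF F(1)] s.height_other[OF F(2,1) F(3)] by metis
    define x where "x = (1 - t) *\<^sub>R v F' + t *\<^sub>R v F"
    have "x \<in> affine hull F"
      using t(3) by (simp flip: height_zero_iff[OF F(1)] add: x_def height_segment[OF F(1)])
    moreover have "x \<in> ?H" using inH by (simp add: x_def inner_add_right algebra_simps)
    moreover have "x \<in> closed_segment (v F') (v F)"
      unfolding closed_segment_def x_def using t by (intro CollectI exI[of _ t]) simp
    ultimately show ?thesis using sub closed_segment_commute by blast
  qed
  then have "apices P v" using v by (simp add: apices_def)
  then show thesis using that Q by blast
qed

section \<open>The one-dimensional case\<close>

lemma facet_singleton: "DIM('a) = 1 \<Longrightarrow> F \<in> facets P \<Longrightarrow> \<exists>p. F = {p}"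
  using facet_aff_dim[of F] aff_dim_eq_0[of F] by simp

text \<open>Here a ridge has \<open>aff_dim\<close> equal to -1 and is empty.\<close>

lemma not_adjacent: "DIM('a) = 1 \<Longrightarrow> \<not> adjacent P F F'"
  using full by (simp add: adjacent_def ridge_of_def aff_dim_empty)

lemma facet_on_segment:
  assumes dim: "DIM('a) = 1" and F: "F \<in> facets P" and "height P F x > 0" "i \<in> interior P"
  obtains s where "0 < s" "F = {(1 - s) *\<^sub>R i + s *\<^sub>R x}"
proof -
  obtain s where s: "0 < s" "(1 - s) * height P F i + s * height P F x = 0"
    using segment_zero height_interior[OF F F] assms by metis
  then have "(1 - s) *\<^sub>R i + s *\<^sub>R x \<in> affine hull F"
    using s(2) by (simp flip: height_zero_iff[OF F] add: height_segment[OF F])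
  then show thesis using facet_singleton[OF dim F] s(1) that by fastforce
qed

text \<open>If \<open>x\<close> were outside two facets, both would be points on the ray from an
  interior point through \<open>x\<close>, at parameters \<open>s\<close> and \<open>t\<close>. Each
  lies in \<open>P\<close>, hence not past the other, so they coincide.\<close>

lemma beyond_one_dim:
  assumes dim: "DIM('a) = 1" and F: "F \<in> facets P" and x: "height P F x > 0"
  shows "beyond P F x"
proof -
  have "height P G x < 0" if G: "G \<in> facets P" "G \<noteq> F" for G
  proof (rule ccontr)
    assume n: "\<not> height P G x < 0"
    have "height P G x \<noteq> 0"
    proof
      assume "height P G x = 0"
      then have "x \<in> affine hull G" using height_zero_iff[OF G(1)] by simp
      then have "x \<in> G" using facet_singleton[OF dim G(1)] by fastforce
      then show False using facet_subset[OF G(1)] height_nonpos[OF F, of x] x by fastforce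
    qed
    then have xG: "height P G x > 0" using n by simp
    obtain i where i: "i \<in> interior P" using interior_nonempty by blast
    obtain s where s: "0 < s" "F = {(1 - s) *\<^sub>R i + s *\<^sub>R x}" by (rule facet_on_segment[OF dim F x i])
    obtain t where t: "0 < t" "G = {(1 - t) *\<^sub>R i + t *\<^sub>R x}" by (rule facet_on_segment[OF dim G(1) xG i])
    have "height P F ((1 - t) *\<^sub>R i + t *\<^sub>R x) \<le> height P F ((1 - s) *\<^sub>R i + s *\<^sub>R x)"
      using height_nonpos[OF F] height_facet[OF F] facet_subset[OF G(1)] s t by simp
    then have "(t - s) * (height P F x - height P F i) \<le> 0"
      unfolding height_segment[OF F] by (simp add: algebra_simps)
    then have "t \<le> s" using height_interior[OF F F i] x by (simp add: mult_le_0_iff)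
    have "height P G ((1 - s) *\<^sub>R i + s *\<^sub>R x) \<le> height P G ((1 - t) *\<^sub>R i + t *\<^sub>R x)"
      using height_nonpos[OF G(1)] height_facet[OF G(1)] facet_subset[OF F] s t by simp
    then have "(s - t) * (height P G x - height P G i) \<le> 0"
      unfolding height_segment[OF G(1)] by (simp add: algebra_simps)
    then have "s \<le> t" using height_interior[OF G(1) G(1) i] xG by (simp add: mult_le_0_iff)
    then show False using \<open>t \<le> s\<close> s t G(2) by simp
  qed
  then show ?thesis using beyond_iff[OF F] x by blast
qed

text \<open>Each facet is a point strictly between the endpoints of \<open>Q\<close>, so exactly one
  endpoint is on its outer side, and \<open>v\<close> picks it. Both endpoints are picked, since
  each lies outside \<open>P\<close> and violates some facet inequality.\<close>

lemma segment_apices: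
  assumes dim: "DIM('a) = 1" and vp: "vertex_preserving_realisation_E P Q"
  obtains v where "apices P v" "Q = convex hull (P \<union> v ` facets P)"
proof -
  obtain a b where Q: "Q = closed_segment a b" and PQ: "P \<subseteq> interior Q"
    using vp full dim by (auto simp: vertex_preserving_realisation_E_def)
  have ab: "a \<notin> P" "b \<notin> P"
    using PQ extreme_point_not_in_interior[of _ Q] Q extreme_point_of_segment by blast+
  have signs: "height P F a > 0 \<and> height P F b < 0 \<or> height P F a < 0 \<and> height P F b > 0"
    if F: "F \<in> facets P" for F
  proof -
    obtain p where p: "F = {p}" using facet_singleton[OF dim F] by blast
    then have "p \<in> Q" using facet_subset[OF F] PQ interior_subset by blast
    then obtain t where t: "0 \<le> t" "t \<le> 1" "p = (1 - t) *\<^sub>R a + t *\<^sub>R b"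
      unfolding Q closed_segment_def by blast
    have "p \<noteq> a" "p \<noteq> b" using ab p facet_subset[OF F] by auto
    then have t': "0 < t" "t < 1" using t by (cases "t = 0"; cases "t = 1"; simp)+
    have "a \<notin> affine hull F" "b \<notin> affine hull F" using \<open>p \<noteq> a\<close> \<open>p \<noteq> b\<close> p by auto
    then have "height P F a \<noteq> 0" "height P F b \<noteq> 0" using height_zero_iff[OF F] by auto
    moreover have "(1 - t) * height P F a + t * height P F b = 0"
      using height_facet[OF F, of p] p t(3) height_segment[OF F] by simp
    ultimately show ?thesis using t'
      by (smt (verit) mult_pos_pos mult_pos_neg)
  qed
  define v where "v F = (if height P F a > 0 then a else b)" for F
  have pos: "height P F (v F) > 0" if "F \<in> facets P" for F
    using signs[OF that] by (auto simp: v_def)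
  have "v ` facets P = {a, b}"
  proof (intro equalityI subsetI)
    fix x assume "x \<in> {a, b}"
    then have "x \<notin> P" using ab by blast
    then obtain F where F: "F \<in> facets P" "\<not> height P F x \<le> 0" using mem_iff by blast
    then have "v F = x" using \<open>x \<in> {a, b}\<close> signs[OF F(1)] by (auto simp: v_def)
    then show "x \<in> v ` facets P" using F by blast
  qed (auto simp: v_def)
  moreover have "convex hull (P \<union> {a, b}) = closed_segment a b"
  proof
    show "convex hull (P \<union> {a, b}) \<subseteq> closed_segment a b"
      using PQ interior_subset[of Q] Q by (intro hull_minimal) auto
    show "closed_segment a b \<subseteq> convex hull (P \<union> {a, b})"
      unfolding segment_convex_hull by (rule hull_mono) blast
  qed
  ultimately have "Q = convex hull (P \<union> v ` facets P)" using Q by simp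
  moreover have "apices P v"
    using beyond_one_dim[OF dim _ pos] not_adjacent[OF dim] by (simp add: apices_def)
  ultimately show thesis using that by blast
qed

text \<open>A nonempty compact convex collinear set is a segment. A point of \<open>P\<close> is
  interior to \<open>P\<close> or forms a facet, to which \<open>near_facet\<close> applies.\<close>

lemma apices_segment:
  assumes dim: "DIM('a) = 1" and v: "apices P v"
  shows "vertex_preserving_realisation_E P (convex hull (P \<union> v ` facets P))"
proof -
  interpret s: stellar P v using v by unfold_locales (simp add: apices_def)
  have "collinear s.Q" using s.aff_dim_Q dim by (simp add: collinear_aff_dim)
  moreover have "s.Q \<noteq> {}" using s.P_subset_Q not_empty by blast
  ultimately obtain a b where "s.Q = closed_segment a b"
    using compact_convex_collinear_segment polytope_imp_compact[OF s.polytope_Q] s.convex_Q by metis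
  moreover have "P \<subseteq> interior s.Q"
  proof
    fix x assume x: "x \<in> P"
    show "x \<in> interior s.Q"
    proof (cases "x \<in> interior P")
      case True
      then show ?thesis using s.interior_P_subset by blast
    next
      case False
      then obtain F where F: "F \<in> facets P" "height P F x \<ge> 0" using notin_interior_imp by metis
      then have "height P F x = 0" using height_nonpos[OF F(1) x] by simp
      then have xF: "x \<in> F" using height_zero_imp F x by blast
      have "height P G x < 0" if G: "G \<in> facets P" "G \<noteq> F" for G
      proof -
        have "x \<notin> G" using facet_singleton[OF dim G(1)] facet_singleton[OF dim F(1)] G(2) xF by fastforce
        then have "height P G x \<noteq> 0" using height_zero_imp[OF G(1) x] by blast
        then show ?thesis using height_nonpos[OF G(1) x] by simp
      qed
      then show ?thesis using s.near_facet[OF F(1) hull_inc[OF xF]] by blast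
    qed
  qed
  moreover have "aff_dim P = 1" using full dim by simp
  ultimately show ?thesis
    unfolding vertex_preserving_realisation_E_def by (auto simp: s.Q_def)
qed

text \<open>From here on the position of the apices stands in for face lattices, in every
  dimension.\<close>

lemma vertex_preserving_iff:
  "vertex_preserving_realisation_E P Q \<longleftrightarrow> (\<exists>v. apices P v \<and> Q = convex hull (P \<union> v ` facets P))"
proof (cases "DIM('a) = 1")
  case True
  then show ?thesis using segment_apices apices_segment by metis
next
  case False
  then have dim: "DIM('a) \<ge> 2" using DIM_positive[where 'a='a] by linarith
  show ?thesis
  proof
    assume "\<exists>v. apices P v \<and> Q = convex hull (P \<union> v ` facets P)"
    then obtain v where v: "apices P v" and Q: "Q = convex hull (P \<union> v ` facets P)" by blast
    interpret s: stellar_realisation P v using v dim by unfold_locales (auto simp: apices_def)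
    show "vertex_preserving_realisation_E P Q" using s.vertex_preserving by (simp add: Q s.Q_def)
  qed (use vertex_preserving_apices[OF dim] in metis)
qed

lemma apices_new_vertices:
  assumes "apices P v"
  shows "new_vertices P (convex hull (P \<union> v ` facets P)) = v ` facets P" and "inj_on v (facets P)"
proof -
  interpret s: stellar P v using assms by unfold_locales (simp add: apices_def)
  show "new_vertices P (convex hull (P \<union> v ` facets P)) = v ` facets P"
    using s.new_vertices_Q by (simp add: s.Q_def)
  show "inj_on v (facets P)" by (rule s.apex_inj)
qed

text \<open>\<open>x\<close> violates only the inequality of \<open>F\<close>, and \<open>y\<close>
  violates none, so along the segment only the height of \<open>F\<close> matters. It decreases
  affinely with its zero at \<open>s\<close>, so the part outside \<open>P\<close> is
  \<open>{0..<s}\<close>.\<close>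

lemma segment_fraction_beyond:
  assumes F: "F \<in> facets P" and x: "beyond P F x" and y: "y \<in> interior P"
  obtains s where "0 < s" "s < 1" "segment_fraction x y (- P) = s" "segment_fraction x y P = 1 - s"
    "\<And>t. (1 - t) *\<^sub>R x + t *\<^sub>R y \<in> affine hull F \<longleftrightarrow> t = s"
proof -
  let ?\<gamma> = "\<lambda>t. (1 - t) *\<^sub>R x + t *\<^sub>R y"
  have pos: "height P F x > 0" and neg: "\<And>G. G \<in> facets P \<Longrightarrow> G \<noteq> F \<Longrightarrow> height P G x < 0"
    using x beyond_iff[OF F] by blast+
  note yneg = height_interior[OF F F y]
  define s where "s = height P F x / (height P F x - height P F y)"
  have s: "0 < s" "s < 1" using pos yneg by (auto simp: s_def divide_simps)
  have eq: "height P F (?\<gamma> t) = (s - t) * (height P F x - height P F y)" for t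
  proof -
    have "s * (height P F x - height P F y) = height P F x" using pos yneg by (simp add: s_def)
    then show ?thesis unfolding height_segment[OF F] by (simp add: algebra_simps)
  qed
  have inP: "?\<gamma> t \<in> P \<longleftrightarrow> s \<le> t" if t: "t \<in> {0..1}" for t
  proof -
    have "height P G (?\<gamma> t) \<le> 0" if G: "G \<in> facets P" "G \<noteq> F" for G
    proof -
      have "height P G x \<le> 0" "height P G y \<le> 0"
        using neg[OF G] height_interior[OF G(1) G(1) y] by simp_all
      then show ?thesis unfolding height_segment[OF G(1)] using t
        by (intro add_nonpos_nonpos mult_nonneg_nonpos) auto
    qed
    then have "?\<gamma> t \<in> P \<longleftrightarrow> height P F (?\<gamma> t) \<le> 0" using mem_iff F by metis
    also have "\<dots> \<longleftrightarrow> s \<le> t" unfolding eq using pos yneg by (simp add: mult_le_0_iff)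
    finally show ?thesis .
  qed
  have "{t \<in> {0..1}. ?\<gamma> t \<in> - P} = {0..<s}" "{t \<in> {0..1}. ?\<gamma> t \<in> P} = {s..1}"
    using inP s by force+
  then have "segment_fraction x y (- P) = s" "segment_fraction x y P = 1 - s"
    using s by (simp_all add: segment_fraction_def)
  moreover have "?\<gamma> t \<in> affine hull F \<longleftrightarrow> t = s" for t
    using eq[of t] height_zero_iff[OF F, of "?\<gamma> t"] pos yneg by auto
  ultimately show thesis using that s by blast
qed

end

section \<open>Products\<close>

text \<open>Slices of the hull of \<open>A \<times> B\<close> are affine: with \<open>x\<close>
  fixed in \<open>A\<close> they contain the hull of \<open>B\<close>, and then with
  \<open>y\<close> fixed in that hull they contain the hull of \<open>A\<close>.\<close>

lemma affine_hull_Times: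
  fixes A :: "'a::euclidean_space set" and B :: "'b::euclidean_space set"
  shows "affine hull (A \<times> B) = (affine hull A) \<times> (affine hull B)"
proof
  have "affine ((affine hull A) \<times> (affine hull B))"
    using affine_affine_hull[of A] affine_affine_hull[of B] unfolding affine_def by auto
  then show "affine hull (A \<times> B) \<subseteq> (affine hull A) \<times> (affine hull B)"
    by (intro hull_minimal Sigma_mono hull_subset) auto
  let ?H = "affine hull (A \<times> B)"
  have aff: "affine {y. (x, y) \<in> ?H}" "affine {x. (x, y) \<in> ?H}" for x y
  proof -
    have "(x, u *\<^sub>R y1 + v *\<^sub>R y2) \<in> ?H"
      if "(x, y1) \<in> ?H" "(x, y2) \<in> ?H" "u + v = 1" for y1 y2 u v
      using mem_affine[OF affine_affine_hull that] that(3) by (simp flip: scaleR_left_distrib)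
    then show "affine {y. (x, y) \<in> ?H}" unfolding affine_def by simp
    have "(u *\<^sub>R x1 + v *\<^sub>R x2, y) \<in> ?H"
      if "(x1, y) \<in> ?H" "(x2, y) \<in> ?H" "u + v = 1" for x1 x2 u v
      using mem_affine[OF affine_affine_hull that] that(3) by (simp flip: scaleR_left_distrib)
    then show "affine {x. (x, y) \<in> ?H}" unfolding affine_def by simp
  qed
  have 1: "(x, y) \<in> ?H" if "x \<in> A" "y \<in> affine hull B" for x y
  proof -
    have "B \<subseteq> {y. (x, y) \<in> ?H}" using that(1) hull_subset[of "A \<times> B" affine] by blast
    then have "affine hull B \<subseteq> {y. (x, y) \<in> ?H}" using aff(1) by (rule hull_minimal)
    then show ?thesis using that by blast
  qed
  show "(affine hull A) \<times> (affine hull B) \<subseteq> ?H"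
  proof clarify
    fix x y assume xy: "x \<in> affine hull A" "y \<in> affine hull B"
    have "A \<subseteq> {x. (x, y) \<in> ?H}" using 1 xy by blast
    then have "affine hull A \<subseteq> {x. (x, y) \<in> ?H}" using aff(2) by (rule hull_minimal)
    then show "(x, y) \<in> ?H" using xy by blast
  qed
qed

text \<open>Translation turns the hulls into subspaces, whose dimensions add.\<close>

lemma aff_dim_Times:
  fixes A :: "'a::euclidean_space set" and B :: "'b::euclidean_space set"
  assumes "A \<noteq> {}" "B \<noteq> {}"
  shows "aff_dim (A \<times> B) = aff_dim A + aff_dim B"
proof -
  obtain a b where ab: "a \<in> A" "b \<in> B" using assms by blast
  define L where "L = (\<lambda>x. x - a) ` (affine hull A)"
  define M where "M = (\<lambda>x. x - b) ` (affine hull B)"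
  have sub: "subspace L" "subspace M"
    using affine_diffs_subspace_subtract[OF affine_affine_hull hull_inc] ab by (simp_all add: L_def M_def)
  have "(\<lambda>x. x - (a, b)) ` ((affine hull A) \<times> (affine hull B)) = L \<times> M"
    by (force simp: L_def M_def)
  moreover have "(a, b) \<in> affine hull (A \<times> B)" using ab by (intro hull_inc) simp
  ultimately have "aff_dim (affine hull (A \<times> B)) = int (dim (L \<times> M))"
    using aff_dim_eq_dim_subtract[of "(a, b)" "affine hull (A \<times> B)"]
    by (simp add: affine_hull_Times hull_hull)
  moreover have "aff_dim (affine hull A) = int (dim L)" "aff_dim (affine hull B) = int (dim M)"
    using aff_dim_eq_dim_subtract[of a "affine hull A"] aff_dim_eq_dim_subtract[of b "affine hull B"] ab
    by (simp_all add: L_def M_def hull_inc hull_hull)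
  ultimately show ?thesis using dim_Times[OF sub] by simp
qed

locale product_polytope = P0: full_polytope P0 + P1: full_polytope P1
  for P0 :: "'a::euclidean_space set" and P1 :: "'b::euclidean_space set"
begin

sublocale prod: full_polytope "P0 \<times> P1"
  using polytope_Times[OF P0.polytope P1.polytope] aff_dim_Times[OF P0.not_empty P1.not_empty]
    P0.full P1.full
  by unfold_locales simp_all

lemma facet_Times_left: "F \<in> facets P0 \<Longrightarrow> F \<times> P1 \<in> facets (P0 \<times> P1)"
  using P0.facet_face[of F] P0.facet_nonempty[of F] P1.not_empty P0.facet_aff_dim[of F] P1.convex
    P0.full P1.full prod.full aff_dim_Times[of F P1]
  by (simp add: facets_def[of "P0 \<times> P1"] facet_of_def face_of_Times face_of_refl)

lemma facet_Times_right: "G \<in> facets P1 \<Longrightarrow> P0 \<times> G \<in> facets (P0 \<times> P1)"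
  using P1.facet_face[of G] P1.facet_nonempty[of G] P0.not_empty P1.facet_aff_dim[of G] P0.convex
    P0.full P1.full prod.full aff_dim_Times[of P0 G]
  by (simp add: facets_def[of "P0 \<times> P1"] facet_of_def face_of_Times face_of_refl)

text \<open>Faces of a product are products of faces; total codimension 1 leaves one factor
  whole.\<close>

lemma facets_Times: "facets (P0 \<times> P1) = (\<lambda>F. F \<times> P1) ` facets P0 \<union> (\<lambda>G. P0 \<times> G) ` facets P1"
proof (intro equalityI subsetI)
  fix K assume K: "K \<in> facets (P0 \<times> P1)"
  then obtain F G where FG: "F face_of P0" "G face_of P1" and KFG: "K = F \<times> G"
    using prod.facet_face face_of_Times_decomp by blast
  have ne: "F \<noteq> {}" "G \<noteq> {}" using prod.facet_nonempty[OF K] KFG by auto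
  have sum: "aff_dim F + aff_dim G = int DIM('a) + int DIM('b) - 1"
    using prod.facet_aff_dim[OF K] aff_dim_Times[OF ne] KFG by simp
  show "K \<in> (\<lambda>F. F \<times> P1) ` facets P0 \<union> (\<lambda>G. P0 \<times> G) ` facets P1"
  proof (cases "G = P1")
    case True
    then have "F \<in> facets P0" using sum FG ne P0.full P1.full by (simp add: facets_def facet_of_def)
    then show ?thesis using True KFG by blast
  next
    case False
    then have "aff_dim G < int DIM('b)" using face_of_aff_dim_lt[OF P1.convex FG(2)] P1.full by simp
    then have "\<not> aff_dim F < int DIM('a)" using sum by linarith
    then have F: "F = P0" using face_of_aff_dim_lt[OF P0.convex FG(1)] P0.full by auto
    then have "G \<in> facets P1" using sum FG ne P0.full P1.full by (simp add: facets_def facet_of_def)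
    then show ?thesis using F KFG by blast
  qed
qed (use facet_Times_left facet_Times_right in blast)

lemma functional_Times_left:
  assumes "facet_functional P0 F h"
  shows "facet_functional (P0 \<times> P1) (F \<times> P1) (h \<circ> fst)"
proof -
  obtain a b where "h = (\<lambda>x. a \<bullet> x - b)" "affine hull F = {y. a \<bullet> y = b}" "P0 \<subseteq> {y. a \<bullet> y \<le> b}"
    using assms unfolding facet_functional_def by blast
  then show ?thesis unfolding facet_functional_def
    by (intro exI[of _ "(a, 0)"] exI[of _ b])
       (auto simp: affine_hull_Times P1.affine_hull_UNIV inner_prod_def)
qed

lemma functional_Times_right:
  assumes "facet_functional P1 G h"
  shows "facet_functional (P0 \<times> P1) (P0 \<times> G) (h \<circ> snd)"
proof -
  obtain a b where "h = (\<lambda>x. a \<bullet> x - b)" "affine hull G = {y. a \<bullet> y = b}" "P1 \<subseteq> {y. a \<bullet> y \<le> b}"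
    using assms unfolding facet_functional_def by blast
  then show ?thesis unfolding facet_functional_def
    by (intro exI[of _ "(0, a)"] exI[of _ b])
       (auto simp: affine_hull_Times P0.affine_hull_UNIV inner_prod_def)
qed

section \<open>Position and adjacency in a product\<close>

lemma sides_Times_left:
  assumes F: "F \<in> facets P0"
  shows "outside_facet (P0 \<times> P1) (F \<times> P1) z \<longleftrightarrow> height P0 F (fst z) > 0"
    and "inside_facet (P0 \<times> P1) (F \<times> P1) z \<longleftrightarrow> height P0 F (fst z) < 0"
  using prod.outside_facet_functional[OF facet_Times_left[OF F] functional_Times_left[OF P0.height[OF F]]]
    prod.inside_facet_functional[OF facet_Times_left[OF F] functional_Times_left[OF P0.height[OF F]]]
  by simp_all

lemma sides_Times_right:
  assumes G: "G \<in> facets P1"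
  shows "outside_facet (P0 \<times> P1) (P0 \<times> G) z \<longleftrightarrow> height P1 G (snd z) > 0"
    and "inside_facet (P0 \<times> P1) (P0 \<times> G) z \<longleftrightarrow> height P1 G (snd z) < 0"
  using prod.outside_facet_functional[OF facet_Times_right[OF G] functional_Times_right[OF P1.height[OF G]]]
    prod.inside_facet_functional[OF facet_Times_right[OF G] functional_Times_right[OF P1.height[OF G]]]
  by simp_all

lemma facet_Times_neq: "F \<in> facets P0 \<Longrightarrow> G \<in> facets P1 \<Longrightarrow> F \<times> P1 \<noteq> P0 \<times> G"
  using P0.facet_aff_dim[of F] P0.full P0.facet_nonempty[of F] P1.not_empty
  by (auto simp: times_eq_iff)

lemma facet_Times_left_eq: "F \<times> P1 = F' \<times> P1 \<longleftrightarrow> F = F'"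
  and facet_Times_right_eq: "P0 \<times> G = P0 \<times> G' \<longleftrightarrow> G = G'"
  using P0.not_empty P1.not_empty by (auto simp: times_eq_iff)

text \<open>The facets \<open>P0 \<times> G\<close> contribute all inequalities of \<open>P1\<close>
  strictly, which describes the interior of \<open>P1\<close>.\<close>

lemma beyond_Times_left:
  assumes F: "F \<in> facets P0"
  shows "beyond (P0 \<times> P1) (F \<times> P1) z \<longleftrightarrow> beyond P0 F (fst z) \<and> snd z \<in> interior P1"
proof -
  have "(\<forall>K \<in> facets (P0 \<times> P1). K \<noteq> F \<times> P1 \<longrightarrow> inside_facet (P0 \<times> P1) K z) \<longleftrightarrow>
      (\<forall>F' \<in> facets P0. F' \<noteq> F \<longrightarrow> height P0 F' (fst z) < 0) \<and>
      (\<forall>G \<in> facets P1. height P1 G (snd z) < 0)" (is "?l \<longleftrightarrow> ?r")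
  proof
    assume l: ?l
    show ?r
    proof (intro conjI ballI impI)
      fix F' assume F': "F' \<in> facets P0" "F' \<noteq> F"
      then have "inside_facet (P0 \<times> P1) (F' \<times> P1) z"
        using l facet_Times_left[OF F'(1)] facet_Times_left_eq[of F' F] by simp
      then show "height P0 F' (fst z) < 0" using sides_Times_left(2)[OF F'(1)] by simp
    next
      fix G assume G: "G \<in> facets P1"
      then have "inside_facet (P0 \<times> P1) (P0 \<times> G) z"
        using l facet_Times_right[OF G] facet_Times_neq[OF F G] by metis
      then show "height P1 G (snd z) < 0" using sides_Times_right(2)[OF G] by simp
    qed
  next
    assume r: ?r
    show ?l
      unfolding facets_Times ball_Un
    proof (intro conjI ballI impI; elim imageE)
      fix K F' assume "K = F' \<times> P1" "F' \<in> facets P0" "K \<noteq> F \<times> P1"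
      then show "inside_facet (P0 \<times> P1) K z" using r sides_Times_left(2)[of F' z] by blast
    next
      fix K G assume "K = P0 \<times> G" "G \<in> facets P1"
      then show "inside_facet (P0 \<times> P1) K z" using r sides_Times_right(2)[of G z] by blast
    qed
  qed
  then show ?thesis
    unfolding beyond_def[of "P0 \<times> P1"] P0.beyond_iff[OF F] P1.interior_iff sides_Times_left(1)[OF F]
    by simp
qed

lemma beyond_Times_right:
  assumes G: "G \<in> facets P1"
  shows "beyond (P0 \<times> P1) (P0 \<times> G) z \<longleftrightarrow> beyond P1 G (snd z) \<and> fst z \<in> interior P0"
proof -
  have "(\<forall>K \<in> facets (P0 \<times> P1). K \<noteq> P0 \<times> G \<longrightarrow> inside_facet (P0 \<times> P1) K z) \<longleftrightarrow>
      (\<forall>G' \<in> facets P1. G' \<noteq> G \<longrightarrow> height P1 G' (snd z) < 0) \<and>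
      (\<forall>F \<in> facets P0. height P0 F (fst z) < 0)" (is "?l \<longleftrightarrow> ?r")
  proof
    assume l: ?l
    show ?r
    proof (intro conjI ballI impI)
      fix G' assume G': "G' \<in> facets P1" "G' \<noteq> G"
      then have "inside_facet (P0 \<times> P1) (P0 \<times> G') z"
        using l facet_Times_right[OF G'(1)] facet_Times_right_eq[of G' G] by simp
      then show "height P1 G' (snd z) < 0" using sides_Times_right(2)[OF G'(1)] by simp
    next
      fix F assume F: "F \<in> facets P0"
      then have "inside_facet (P0 \<times> P1) (F \<times> P1) z"
        using l facet_Times_left[OF F] facet_Times_neq[OF F G] by metis
      then show "height P0 F (fst z) < 0" using sides_Times_left(2)[OF F] by simp
    qed
  next
    assume r: ?r
    show ?l
      unfolding facets_Times ball_Un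
    proof (intro conjI ballI impI; elim imageE)
      fix K F assume "K = F \<times> P1" "F \<in> facets P0"
      then show "inside_facet (P0 \<times> P1) K z" using r sides_Times_left(2)[of F z] by blast
    next
      fix K G' assume "K = P0 \<times> G'" "G' \<in> facets P1" "K \<noteq> P0 \<times> G"
      then show "inside_facet (P0 \<times> P1) K z" using r sides_Times_right(2)[of G' z] by blast
    qed
  qed
  then show ?thesis
    unfolding beyond_def[of "P0 \<times> P1"] P1.beyond_iff[OF G] P0.interior_iff sides_Times_right(1)[OF G]
    by simp
qed

text \<open>Nonemptiness in \<open>adjacent\<close> matters here: the endpoints of a segment
  \<open>P0\<close> meet in the empty set, which has the dimension of a ridge, whereas their
  products with \<open>P1\<close> are facets without a common ridge.\<close>

lemma adjacent_Times_left: "adjacent (P0 \<times> P1) (F \<times> P1) (F' \<times> P1) \<longleftrightarrow> adjacent P0 F F'"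
  if "F \<in> facets P0" "F' \<in> facets P0"
proof (cases "F \<inter> F' = {}")
  case True
  then show ?thesis by (auto simp: adjacent_def)
next
  case False
  have "F \<times> P1 \<inter> F' \<times> P1 = (F \<inter> F') \<times> P1" by blast
  moreover have "(F \<inter> F') \<times> P1 face_of P0 \<times> P1 \<longleftrightarrow> F \<inter> F' face_of P0"
    using False P1.not_empty P1.convex by (simp add: face_of_Times_eq face_of_refl)
  moreover have "aff_dim ((F \<inter> F') \<times> P1) = aff_dim (F \<inter> F') + int DIM('b)"
    using aff_dim_Times[OF False P1.not_empty] P1.full by simp
  ultimately show ?thesis
    using that facet_Times_left False P1.not_empty P0.full prod.full
    by (simp add: adjacent_def ridge_of_def facet_Times_left_eq)
qed

lemma adjacent_Times_right: "adjacent (P0 \<times> P1) (P0 \<times> G) (P0 \<times> G') \<longleftrightarrow> adjacent P1 G G'"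
  if "G \<in> facets P1" "G' \<in> facets P1"
proof (cases "G \<inter> G' = {}")
  case True
  then show ?thesis by (auto simp: adjacent_def)
next
  case False
  have "P0 \<times> G \<inter> P0 \<times> G' = P0 \<times> (G \<inter> G')" by blast
  moreover have "P0 \<times> (G \<inter> G') face_of P0 \<times> P1 \<longleftrightarrow> G \<inter> G' face_of P1"
    using False P0.not_empty P0.convex by (simp add: face_of_Times_eq face_of_refl)
  moreover have "aff_dim (P0 \<times> (G \<inter> G')) = int DIM('a) + aff_dim (G \<inter> G')"
    using aff_dim_Times[OF P0.not_empty False] P0.full by simp
  ultimately show ?thesis
    using that facet_Times_right False P0.not_empty P1.full prod.full
    by (simp add: adjacent_def ridge_of_def facet_Times_right_eq)
qed

lemma adjacent_Times_mixed:
  assumes F: "F \<in> facets P0" and G: "G \<in> facets P1"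
  shows "adjacent (P0 \<times> P1) (F \<times> P1) (P0 \<times> G)"
proof -
  have eq: "F \<times> P1 \<inter> P0 \<times> G = F \<times> G" using P0.facet_subset[OF F] P1.facet_subset[OF G] by blast
  have ne: "F \<noteq> {}" "G \<noteq> {}" using P0.facet_nonempty[OF F] P1.facet_nonempty[OF G] .
  have "F \<times> G ridge_of P0 \<times> P1"
    using face_of_Times[OF P0.facet_face[OF F] P1.facet_face[OF G]] aff_dim_Times[OF ne]
      P0.facet_aff_dim[OF F] P1.facet_aff_dim[OF G] prod.full by (simp add: ridge_of_def)
  then show ?thesis unfolding adjacent_def eq
    using facet_Times_left[OF F] facet_Times_right[OF G] facet_Times_neq[OF F G] ne by simp
qed

text \<open>For two facets from the same factor the condition projects to that factor, since
  coordinate images of segments are segments. Only the ridges \<open>F \<times> G\<close> couple the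
  factors: one point \<open>z\<close> must serve both hulls.\<close>

lemma apices_Times_iff:
  "apices (P0 \<times> P1) w \<longleftrightarrow>
     apices P0 (\<lambda>F. fst (w (F \<times> P1))) \<and> apices P1 (\<lambda>G. snd (w (P0 \<times> G))) \<and>
     (\<forall>F \<in> facets P0. snd (w (F \<times> P1)) \<in> interior P1) \<and>
     (\<forall>G \<in> facets P1. fst (w (P0 \<times> G)) \<in> interior P0) \<and>
     (\<forall>F \<in> facets P0. \<forall>G \<in> facets P1. \<exists>z \<in> closed_segment (w (F \<times> P1)) (w (P0 \<times> G)).
        fst z \<in> affine hull F \<and> snd z \<in> affine hull G)"
  (is "_ \<longleftrightarrow> ?rhs")
proof -
  let ?meets = "\<lambda>K L. \<exists>z \<in> closed_segment (w K) (w L). z \<in> affine hull K \<and> z \<in> affine hull L"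
  have hullL: "z \<in> affine hull (F \<times> P1) \<longleftrightarrow> fst z \<in> affine hull F" for z and F :: "'a set"
    by (simp add: affine_hull_Times P1.affine_hull_UNIV mem_Times_iff)
  have hullR: "z \<in> affine hull (P0 \<times> G) \<longleftrightarrow> snd z \<in> affine hull G" for z and G :: "'b set"
    by (simp add: affine_hull_Times P0.affine_hull_UNIV mem_Times_iff)
  have fst_seg: "fst ` closed_segment z z' = closed_segment (fst z) (fst z')"
    and snd_seg: "snd ` closed_segment z z' = closed_segment (snd z) (snd z')" for z z' :: "'a \<times> 'b"
    by (simp_all add: closed_segment_linear_image linear_fst linear_snd)
  have L: "?meets (F \<times> P1) (F' \<times> P1) \<longleftrightarrow>
      (\<exists>x \<in> closed_segment (fst (w (F \<times> P1))) (fst (w (F' \<times> P1))). x \<in> affine hull F \<and> x \<in> affine hull F')" for F F'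
    unfolding hullL fst_seg[symmetric] by blast
  have R: "?meets (P0 \<times> G) (P0 \<times> G') \<longleftrightarrow>
      (\<exists>x \<in> closed_segment (snd (w (P0 \<times> G))) (snd (w (P0 \<times> G'))). x \<in> affine hull G \<and> x \<in> affine hull G')" for G G'
    unfolding hullR snd_seg[symmetric] by blast
  have M: "?meets (F \<times> P1) (P0 \<times> G) \<longleftrightarrow> (\<exists>z \<in> closed_segment (w (F \<times> P1)) (w (P0 \<times> G)).
        fst z \<in> affine hull F \<and> snd z \<in> affine hull G)" for F G
    unfolding hullL hullR ..
  have M': "?meets (P0 \<times> G) (F \<times> P1) \<longleftrightarrow> ?meets (F \<times> P1) (P0 \<times> G)" for F G
    by (subst closed_segment_commute) blast
  have adj_facets: "adjacent P F F' \<Longrightarrow> F \<in> facets P \<and> F' \<in> facets P"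
    for P :: "'c::euclidean_space set" and F F' by (simp add: adjacent_def)
  show ?thesis
  proof
    assume w: "apices (P0 \<times> P1) w"
    then have bey: "beyond (P0 \<times> P1) K (w K)" if "K \<in> facets (P0 \<times> P1)" for K
      using that by (simp add: apices_def)
    have meets: "?meets K L" if "adjacent (P0 \<times> P1) K L" for K L
      using w that unfolding apices_def by blast
    have 1: "beyond P0 F (fst (w (F \<times> P1))) \<and> snd (w (F \<times> P1)) \<in> interior P1" if "F \<in> facets P0" for F
      using bey[OF facet_Times_left[OF that]] beyond_Times_left[OF that] by simp
    have 2: "beyond P1 G (snd (w (P0 \<times> G))) \<and> fst (w (P0 \<times> G)) \<in> interior P0" if "G \<in> facets P1" for G
      using bey[OF facet_Times_right[OF that]] beyond_Times_right[OF that] by simp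
    have "apices P0 (\<lambda>F. fst (w (F \<times> P1)))"
      unfolding apices_def
    proof (intro conjI allI impI ballI)
      fix F F' assume "adjacent P0 F F'"
      then have "?meets (F \<times> P1) (F' \<times> P1)" using meets adjacent_Times_left adj_facets by metis
      then show "\<exists>x \<in> closed_segment (fst (w (F \<times> P1))) (fst (w (F' \<times> P1))). x \<in> affine hull F \<and> x \<in> affine hull F'"
        using L by (rule iffD1[rotated])
    qed (simp add: 1)
    moreover have "apices P1 (\<lambda>G. snd (w (P0 \<times> G)))"
      unfolding apices_def
    proof (intro conjI allI impI ballI)
      fix G G' assume "adjacent P1 G G'"
      then have "?meets (P0 \<times> G) (P0 \<times> G')" using meets adjacent_Times_right adj_facets by metis
      then show "\<exists>x \<in> closed_segment (snd (w (P0 \<times> G))) (snd (w (P0 \<times> G'))). x \<in> affine hull G \<and> x \<in> affine hull G'"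
        using R by (rule iffD1[rotated])
    qed (simp add: 2)
    moreover have "\<exists>z \<in> closed_segment (w (F \<times> P1)) (w (P0 \<times> G)). fst z \<in> affine hull F \<and> snd z \<in> affine hull G"
      if "F \<in> facets P0" "G \<in> facets P1" for F G
      using meets[OF adjacent_Times_mixed[OF that]] M by (rule iffD1[rotated])
    ultimately show ?rhs using 1 2 by (intro conjI ballI) simp_all
  next
    assume r: ?rhs
    show "apices (P0 \<times> P1) w"
      unfolding apices_def
    proof (intro conjI allI impI ballI)
      fix K assume "K \<in> facets (P0 \<times> P1)"
      then consider (L) F where "F \<in> facets P0" "K = F \<times> P1" | (R) G where "G \<in> facets P1" "K = P0 \<times> G"
        unfolding facets_Times by blast
      then show "beyond (P0 \<times> P1) K (w K)"
      proof cases
        case L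
        then show ?thesis using r beyond_Times_left[OF L(1)] by (simp add: apices_def)
      next
        case R
        then show ?thesis using r beyond_Times_right[OF R(1)] by (simp add: apices_def)
      qed
    next
      fix K L assume adj: "adjacent (P0 \<times> P1) K L"
      have mixed: "?meets (F \<times> P1) (P0 \<times> G)" if "F \<in> facets P0" "G \<in> facets P1" for F G
        using M r that by simp
      have "K \<in> facets (P0 \<times> P1)" "L \<in> facets (P0 \<times> P1)" using adj by (simp_all add: adjacent_def)
      then consider (LL) F F' where "F \<in> facets P0" "K = F \<times> P1" "F' \<in> facets P0" "L = F' \<times> P1"
        | (LR) F G where "F \<in> facets P0" "K = F \<times> P1" "G \<in> facets P1" "L = P0 \<times> G"
        | (RL) F G where "F \<in> facets P0" "L = F \<times> P1" "G \<in> facets P1" "K = P0 \<times> G"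
        | (RR) G G' where "G \<in> facets P1" "K = P0 \<times> G" "G' \<in> facets P1" "L = P0 \<times> G'"
        unfolding facets_Times by blast
      then show "?meets K L"
      proof cases
        case LL
        then have "adjacent P0 F F'" using adj adjacent_Times_left by simp
        then show ?thesis unfolding LL(2,4) L using r unfolding apices_def by blast
      next
        case LR
        then show ?thesis using mixed by simp
      next
        case RL
        then show ?thesis using mixed M' by simp
      next
        case RR
        then have "adjacent P1 G G'" using adj adjacent_Times_right by simp
        then show ?thesis unfolding RR(2,4) R using r unfolding apices_def by blast
      qed
    qed
  qed
qed

text \<open>A point \<open>z\<close> has one parameter for both coordinates. The first runs from
  \<open>v0\<close> to \<open>b1\<close> and meets the hull of \<open>F\<close> at the outside
  fraction \<open>s\<close>. The second runs from \<open>b0\<close> to \<open>v1\<close>, opposite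
  to the segment measured in (B), and so meets the hull of \<open>G\<close> at \<open>1 - u\<close>,
  the inside fraction.\<close>

lemma segment_fractions_eq_iff:
  assumes F: "F \<in> facets P0" "beyond P0 F v0" "b0 \<in> interior P1"
    and G: "G \<in> facets P1" "beyond P1 G v1" "b1 \<in> interior P0"
  shows "segment_fraction v0 b1 (- P0) = segment_fraction v1 b0 P1 \<longleftrightarrow>
    (\<exists>z \<in> closed_segment (v0, b0) (b1, v1). fst z \<in> affine hull F \<and> snd z \<in> affine hull G)"
proof -
  obtain s where s: "0 < s" "s < 1" "segment_fraction v0 b1 (- P0) = s"
    "\<And>t. (1 - t) *\<^sub>R v0 + t *\<^sub>R b1 \<in> affine hull F \<longleftrightarrow> t = s"
    using P0.segment_fraction_beyond[OF F(1,2) G(3)] by metis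
  obtain u where u: "0 < u" "u < 1" "segment_fraction v1 b0 P1 = 1 - u"
    "\<And>t. (1 - t) *\<^sub>R v1 + t *\<^sub>R b0 \<in> affine hull G \<longleftrightarrow> t = u"
    using P1.segment_fraction_beyond[OF G(1,2) F(3)] by metis
  have uG: "(1 - t) *\<^sub>R b0 + t *\<^sub>R v1 \<in> affine hull G \<longleftrightarrow> t = 1 - u" for t
    using u(4)[of "1 - t"] by (auto simp: add.commute)
  have "(\<exists>z \<in> closed_segment (v0, b0) (b1, v1). fst z \<in> affine hull F \<and> snd z \<in> affine hull G) \<longleftrightarrow>
     (\<exists>t. 0 \<le> t \<and> t \<le> 1 \<and> t = s \<and> t = 1 - u)"
    unfolding s(4)[symmetric] uG[symmetric] closed_segment_def by auto
  then show ?thesis using s u by auto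
qed

text \<open>Each factor is the hull of its vertices and hulls commute with products, so the vertex
  pairs may be replaced by \<open>P0 \<times> P1\<close>.\<close>

lemma convex_hull_product_points:
  "convex hull (product_points P0 P1 T0 T1 \<beta>0 \<beta>1) =
   convex hull (P0 \<times> P1 \<union> ((\<lambda>x. (x, \<beta>0 x)) ` T0 \<union> (\<lambda>y. (\<beta>1 y, y)) ` T1))"
proof -
  have "P0 = convex hull (vertices P0)" "P1 = convex hull (vertices P1)"
    using Krein_Milman_Minkowski P0.compact P0.convex P1.compact P1.convex by (auto simp: vertices_def)
  then have P: "P0 \<times> P1 = convex hull (vertices P0 \<times> vertices P1)" by (metis convex_hull_Times)
  have "product_points P0 P1 T0 T1 \<beta>0 \<beta>1 =
      vertices P0 \<times> vertices P1 \<union> ((\<lambda>x. (x, \<beta>0 x)) ` T0 \<union> (\<lambda>y. (\<beta>1 y, y)) ` T1)"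
    by (auto simp: product_points_def)
  then show ?thesis unfolding P by (metis hull_Un_left)
qed

lemma product_realisation:
  assumes vp: "vertex_preserving_realisation_E P0 Q0" "vertex_preserving_realisation_E P1 Q1"
    and B: "condition_B P0 P1 (new_vertices P0 Q0) (new_vertices P1 Q1) \<beta>0 \<beta>1"
  shows "vertex_preserving_realisation_E (P0 \<times> P1)
    (convex hull (product_points P0 P1 (new_vertices P0 Q0) (new_vertices P1 Q1) \<beta>0 \<beta>1))"
proof -
  obtain v0 where v0: "apices P0 v0" "Q0 = convex hull (P0 \<union> v0 ` facets P0)"
    using vp(1) P0.vertex_preserving_iff by blast
  obtain v1 where v1: "apices P1 v1" "Q1 = convex hull (P1 \<union> v1 ` facets P1)"
    using vp(2) P1.vertex_preserving_iff by blast
  have T0: "new_vertices P0 Q0 = v0 ` facets P0" using P0.apices_new_vertices(1)[OF v0(1)] v0(2) by simp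
  have T1: "new_vertices P1 Q1 = v1 ` facets P1" using P1.apices_new_vertices(1)[OF v1(1)] v1(2) by simp
  have int0: "\<beta>0 (v0 F) \<in> interior P1" if "F \<in> facets P0" for F
    using B that unfolding condition_B_def T0 by blast
  have int1: "\<beta>1 (v1 G) \<in> interior P0" if "G \<in> facets P1" for G
    using B that unfolding condition_B_def T1 by blast
  \<comment> \<open>The image under \<open>snd\<close> tells the two kinds of facets apart: it is
    \<open>P1\<close> for \<open>F \<times> P1\<close> and \<open>G \<noteq> P1\<close> for
    \<open>P0 \<times> G\<close>.\<close>
  define w where "w K = (if snd ` K = P1 then (v0 (fst ` K), \<beta>0 (v0 (fst ` K)))
     else (\<beta>1 (v1 (snd ` K)), v1 (snd ` K)))" for K
  have wL: "w (F \<times> P1) = (v0 F, \<beta>0 (v0 F))" if "F \<in> facets P0" for F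
    using P0.facet_nonempty[OF that] P1.not_empty by (simp add: w_def)
  have wR: "w (P0 \<times> G) = (\<beta>1 (v1 G), v1 G)" if "G \<in> facets P1" for G
    using P1.facet_aff_dim[OF that] P1.full P0.not_empty by (auto simp: w_def)
  have "apices (P0 \<times> P1) w"
    unfolding apices_Times_iff
  proof (intro conjI ballI)
    show "apices P0 (\<lambda>F. fst (w (F \<times> P1)))"
      using v0(1) wL unfolding apices_def adjacent_def by simp
    show "apices P1 (\<lambda>G. snd (w (P0 \<times> G)))"
      using v1(1) wR unfolding apices_def adjacent_def by simp
    fix F assume F: "F \<in> facets P0"
    show "snd (w (F \<times> P1)) \<in> interior P1" using wL[OF F] int0[OF F] by simp
    fix G assume G: "G \<in> facets P1"
    have "beyond P0 F (v0 F)" "beyond P1 G (v1 G)" using v0 v1 F G by (simp_all add: apices_def)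
    moreover have "segment_fraction (v0 F) (\<beta>1 (v1 G)) (- P0) = segment_fraction (v1 G) (\<beta>0 (v0 F)) P1"
      using B F G unfolding condition_B_def T0 T1 by blast
    ultimately show "\<exists>z \<in> closed_segment (w (F \<times> P1)) (w (P0 \<times> G)). fst z \<in> affine hull F \<and> snd z \<in> affine hull G"
      unfolding wL[OF F] wR[OF G] using segment_fractions_eq_iff F G int0 int1 by blast
  next
    fix G assume "G \<in> facets P1"
    then show "fst (w (P0 \<times> G)) \<in> interior P0" using wR int1 by simp
  qed
  moreover have "w ` facets (P0 \<times> P1) = (\<lambda>x. (x, \<beta>0 x)) ` v0 ` facets P0 \<union> (\<lambda>y. (\<beta>1 y, y)) ` v1 ` facets P1"
    unfolding facets_Times image_Un image_image using wL wR by simp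
  ultimately show ?thesis
    unfolding prod.vertex_preserving_iff convex_hull_product_points T0 T1 by metis
qed

lemma product_realisation_factors:
  assumes "vertex_preserving_realisation_E (P0 \<times> P1) Q"
  obtains Q0 Q1 \<beta>0 \<beta>1 where "vertex_preserving_realisation_E P0 Q0" "vertex_preserving_realisation_E P1 Q1"
    "condition_B P0 P1 (new_vertices P0 Q0) (new_vertices P1 Q1) \<beta>0 \<beta>1"
proof -
  obtain w where w: "apices (P0 \<times> P1) w" using assms prod.vertex_preserving_iff by blast
  define v0 where "v0 F = fst (w (F \<times> P1))" for F
  define v1 where "v1 G = snd (w (P0 \<times> G))" for G
  have v0: "apices P0 v0" and v1: "apices P1 v1"
    and int0: "\<And>F. F \<in> facets P0 \<Longrightarrow> snd (w (F \<times> P1)) \<in> interior P1"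
    and int1: "\<And>G. G \<in> facets P1 \<Longrightarrow> fst (w (P0 \<times> G)) \<in> interior P0"
    and meets: "\<And>F G. F \<in> facets P0 \<Longrightarrow> G \<in> facets P1 \<Longrightarrow>
      \<exists>z \<in> closed_segment (w (F \<times> P1)) (w (P0 \<times> G)). fst z \<in> affine hull F \<and> snd z \<in> affine hull G"
    using w unfolding apices_Times_iff v0_def[abs_def] v1_def[abs_def] by simp_all
  define Q0 where "Q0 = convex hull (P0 \<union> v0 ` facets P0)"
  define Q1 where "Q1 = convex hull (P1 \<union> v1 ` facets P1)"
  \<comment> \<open>The maps take a new vertex, not a facet, as argument; injectivity of
    \<open>v0\<close> and \<open>v1\<close> recovers the facet.\<close>
  define \<beta>0 where "\<beta>0 x = snd (w (the_inv_into (facets P0) v0 x \<times> P1))" for x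
  define \<beta>1 where "\<beta>1 y = fst (w (P0 \<times> the_inv_into (facets P1) v1 y))" for y
  have \<beta>0: "\<beta>0 (v0 F) = snd (w (F \<times> P1))" if "F \<in> facets P0" for F
    using the_inv_into_f_f[OF P0.apices_new_vertices(2)[OF v0] that] by (simp add: \<beta>0_def)
  have \<beta>1: "\<beta>1 (v1 G) = fst (w (P0 \<times> G))" if "G \<in> facets P1" for G
    using the_inv_into_f_f[OF P1.apices_new_vertices(2)[OF v1] that] by (simp add: \<beta>1_def)
  have T: "new_vertices P0 Q0 = v0 ` facets P0" "new_vertices P1 Q1 = v1 ` facets P1"
    using P0.apices_new_vertices(1)[OF v0] P1.apices_new_vertices(1)[OF v1] by (simp_all add: Q0_def Q1_def)
  have "segment_fraction (v0 F) (\<beta>1 (v1 G)) (- P0) = segment_fraction (v1 G) (\<beta>0 (v0 F)) P1"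
    if F: "F \<in> facets P0" and G: "G \<in> facets P1" for F G
  proof -
    have bey: "beyond P0 F (v0 F)" "beyond P1 G (v1 G)" using v0 v1 F G by (simp_all add: apices_def)
    have "w (F \<times> P1) = (v0 F, \<beta>0 (v0 F))" "w (P0 \<times> G) = (\<beta>1 (v1 G), v1 G)"
      using \<beta>0[OF F] \<beta>1[OF G] by (simp_all add: v0_def v1_def)
    then show ?thesis
      using segment_fractions_eq_iff[OF F bey(1) _ G bey(2)] meets[OF F G] int0[OF F] int1[OF G] by simp
  qed
  then have "condition_B P0 P1 (new_vertices P0 Q0) (new_vertices P1 Q1) \<beta>0 \<beta>1"
    unfolding condition_B_def T using \<beta>0 \<beta>1 int0 int1 by auto
  moreover have "vertex_preserving_realisation_E P0 Q0" "vertex_preserving_realisation_E P1 Q1"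
    unfolding P0.vertex_preserving_iff P1.vertex_preserving_iff Q0_def Q1_def using v0 v1 by blast+
  ultimately show thesis using that by blast
qed

end

theorem theorem2p1:
  fixes P0 :: "'a::euclidean_space set" and P1 :: "'b::euclidean_space set"
  assumes "polytope P0" and "polytope P1"
    and "aff_dim P0 = int DIM('a)" and "aff_dim P1 = int DIM('b)"
    and "DIM('a) \<ge> 1" and "DIM('b) \<ge> 1"
    and "DIM('a) + DIM('b) \<ge> 3"
  shows "(\<forall>Q0 Q1 \<beta>0 \<beta>1.
            vertex_preserving_realisation_E P0 Q0 \<and> vertex_preserving_realisation_E P1 Q1 \<and>
            condition_B P0 P1 (new_vertices P0 Q0) (new_vertices P1 Q1) \<beta>0 \<beta>1 \<longrightarrow>
            vertex_preserving_realisation_E (P0 \<times> P1)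
              (convex hull (product_points P0 P1 (new_vertices P0 Q0) (new_vertices P1 Q1) \<beta>0 \<beta>1)))
       \<and> ((\<exists>Q. vertex_preserving_realisation_E (P0 \<times> P1) Q) \<longleftrightarrow>
           (\<exists>Q0 Q1. vertex_preserving_realisation_E P0 Q0 \<and> vertex_preserving_realisation_E P1 Q1 \<and>
              (\<exists>\<beta>0 \<beta>1.
                 condition_B P0 P1 (new_vertices P0 Q0) (new_vertices P1 Q1) \<beta>0 \<beta>1)))"
proof -
  interpret product_polytope P0 P1 using assms by unfold_locales
  show ?thesis
  proof (intro conjI allI impI iffI)
    assume "\<exists>Q. vertex_preserving_realisation_E (P0 \<times> P1) Q"
    then show "\<exists>Q0 Q1. vertex_preserving_realisation_E P0 Q0 \<and> vertex_preserving_realisation_E P1 Q1 \<and>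
        (\<exists>\<beta>0 \<beta>1. condition_B P0 P1 (new_vertices P0 Q0) (new_vertices P1 Q1) \<beta>0 \<beta>1)"
      by (elim exE, elim product_realisation_factors) blast
  qed (use product_realisation in blast)+
qed

end
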